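(* Let $\alpha>0$ be a real number and let $1\le k\le l$ be integers. Consider the two-class TASEP on the half-line $\mathbb{Z}_{\ge 1}$ with a source of rate $\alpha$ at position $1$ (as defined in the context), started from the configuration $$\eta(1)=\dots=\eta(k-1)=1,\qquad \eta(k)=\dots=\eta(l-1)=+\infty,\qquad \eta(l)=2,\qquad \eta(x)=+\infty \ \text{ for } x>l .$$ Then the probability that the (unique) second class particle eventually exits the system is equal to $$\frac{1+(2\rho_\alpha(k)-1)(l-k+1)}{2^{\,l-k+1}}\qquad\text{if }\alpha\ge 1/2,$$ and it is equal to $\alpha^{\,l-k+1}$ if $\alpha\le 1/2$.
   Context: Two-class TASEP on the half-line with a source: this is a continuous time Markov process on configurations $\eta:\mathbb{Z}_{\ge 1}\to\{1,2,+\infty\}$. Here $\eta(x)=1$ means that position $x$ contains a first class particle, $\eta(x)=2$ means that it contains a second class particle, and $\eta(x)=+\infty$ means that it contains a hole (is empty). The values are ordered by $1<2<+\infty$. All transitions are driven by independent exponential clocks. Bulk: for each $x\ge 1$, if $\eta(x)<\eta(x+1)$, then the values at positions $x$ and $x+1$ are swapped at rate $1$. Thus particles jump to the right at rate $1$ into holes, and a first class particle exchanges places with a second class particle immediately to its right at rate $1$. No other bulk transitions occur; in particular there are no jumps to the left in which a particle moves into a hole. Boundary: if position $1$ contains a second class particle or a hole, then at rate $\alpha$ it is replaced by a first class particle. If the replaced object was the second class particle, that particle disappears permanently from the system ("exits the system"). Only first class particles are injected. The function $\rho_\alpha:\mathbb{Z}_{\ge 1}\to\mathbb{R}$ is defined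 by $$\rho_\alpha(1):=1-\frac{1}{4\alpha},\qquad \rho_\alpha(z):=\frac{1}{4^{z}}\sum_{k=2}^{z}\frac{(2(z-1)-k)!\,(k-1)}{(z-1)!\,(z-k)!}\left((1+k)2^{k}-\alpha^{-k}\right)\quad\text{for } z\ge 2,$$ where $k$ in the sum is a summation index. *)

theory Defs
  imports "HOL-Probability.Probability"
begin

section \<open>Continuous-time Markov chains with given jump rates\<close>

definition exit_rate :: "('s \<Rightarrow> 's \<Rightarrow> real) \<Rightarrow> 's \<Rightarrow> real" where
  "exit_rate q x = (\<Sum>\<^sub>\<infinity>y. q x y)"

definition jump_time :: "(nat \<Rightarrow> 'w \<Rightarrow> real) \<Rightarrow> nat \<Rightarrow> 'w \<Rightarrow> real" where
  "jump_time S n \<omega> = (\<Sum>i<n. S i \<omega>)"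

text \<open>
  \<open>jump_chain_law M q Y S\<close>: given the states \<open>Y 0, \<dots>, Y n\<close> and the holding times
  \<open>S 0, \<dots>, S (n - 1)\<close>, independent exponential clocks of rates \<open>q (Y n) y\<close>, one for
  each target \<open>y\<close>, compete. So the holding time \<open>S n\<close> is exponential of parameter
  \<open>exit_rate q (Y n)\<close> and, independently of it, the chain moves to \<open>y\<close> with probability
  \<open>q (Y n) y / exit_rate q (Y n)\<close>. This is meant for rates \<open>q\<close> such that every state visited has
  a positive finite exit rate and \<open>q x x = 0\<close>.
\<close>

definition jump_chain_law ::
  "'w measure \<Rightarrow> ('s \<Rightarrow> 's \<Rightarrow> real) \<Rightarrow> (nat \<Rightarrow> 'w \<Rightarrow> 's) \<Rightarrow> (nat \<Rightarrow> 'w \<Rightarrow> real) \<Rightarrow> bool" where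
  "jump_chain_law M q Y S \<longleftrightarrow>
    (\<forall>n (y :: nat \<Rightarrow> 's) (s :: nat \<Rightarrow> real). (\<forall>i\<le>n. 0 \<le> s i) \<longrightarrow>
      measure M {\<omega> \<in> space M. (\<forall>i\<le>Suc n. Y i \<omega> = y i) \<and> (\<forall>i\<le>n. s i < S i \<omega>)} =
      measure M {\<omega> \<in> space M. (\<forall>i\<le>n. Y i \<omega> = y i) \<and> (\<forall>i<n. s i < S i \<omega>)}
        * (q (y n) (y (Suc n)) / exit_rate q (y n))
        * exp (- exit_rate q (y n) * s n))"

text \<open>
  \<open>markov_jump_process M q x0 X\<close>: on the probability space \<open>M\<close>, the process
  \<open>X t\<close>, \<open>t \<ge> 0\<close>, is a continuous-time Markov chain with jump rates \<open>q\<close> started from \<open>x0\<close>, with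
  right-continuous step paths. It visits only countably many states almost surely, hence the discrete
  sigma-algebra on the state space. The last clause makes every path defined for
  all times \<open>t \<ge> 0\<close>, i.e. the jump times do not accumulate.
\<close>

definition markov_jump_process ::
  "'w measure \<Rightarrow> ('s \<Rightarrow> 's \<Rightarrow> real) \<Rightarrow> 's \<Rightarrow> (real \<Rightarrow> 'w \<Rightarrow> 's) \<Rightarrow> bool" where
  "markov_jump_process M q x0 X \<longleftrightarrow> prob_space M \<and>
    (\<exists>Y S.
      (\<forall>n. Y n \<in> measurable M (count_space UNIV)) \<and>
      (\<forall>n. S n \<in> borel_measurable M) \<and>
      (\<forall>\<omega>\<in>space M. Y 0 \<omega> = x0) \<and>
      (\<forall>n. \<forall>\<omega>\<in>space M. 0 < S n \<omega>) \<and>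
      jump_chain_law M q Y S \<and>
      (\<forall>\<omega>\<in>space M. \<forall>t\<ge>0. \<exists>n.
        jump_time S n \<omega> \<le> t \<and> t < jump_time S (Suc n) \<omega> \<and> X t \<omega> = Y n \<omega>))"


section \<open>Two-class TASEP on the half-line with a source\<close>

datatype species = First | Second | Hole

fun label :: "species \<Rightarrow> enat" where
  "label First = 1"
| "label Second = 2"
| "label Hole = \<infinity>"

text \<open>The sites are the positive integers; the value at index \<open>0\<close> has no meaning and is never
  changed by the dynamics.\<close>

type_synonym config = "nat \<Rightarrow> species"

definition swap_at :: "nat \<Rightarrow> config \<Rightarrow> config" where
  "swap_at x \<eta> = \<eta>(x := \<eta> (x + 1), x + 1 := \<eta> x)"

definition inject :: "config \<Rightarrow> config" where
  "inject \<eta> = \<eta>(1 := First)"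

text \<open>The rate of a move from \<open>\<eta>\<close> to \<open>\<eta>'\<close> adds up the rates of all transitions turning
  \<open>\<eta>\<close> into \<open>\<eta>'\<close>; the cardinality counts the bonds (at most one) whose swap does so. The exit rate
  of \<open>\<eta>\<close> is finite exactly when finitely many bonds can be swapped, in particular whenever
  \<open>\<eta>\<close> has finitely many particles, a property the dynamics preserves.\<close>

definition tasep_rate :: "real \<Rightarrow> config \<Rightarrow> config \<Rightarrow> real" where
  "tasep_rate \<alpha> \<eta> \<eta>' =
    real (card {x. 1 \<le> x \<and> label (\<eta> x) < label (\<eta> (x + 1)) \<and> \<eta>' = swap_at x \<eta>})
    + (if \<eta> 1 \<noteq> First \<and> \<eta>' = inject \<eta> then \<alpha> else 0)"

definition init_config :: "nat \<Rightarrow> nat \<Rightarrow> config" where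
  "init_config k l x = (if 1 \<le> x \<and> x < k then First else if x = l then Second else Hole)"

text \<open>A second class particle can leave the system only through the source, and none is ever
  injected; so a lone second class particle has exited by time \<open>t\<close> iff there is none left.\<close>

definition exit_event :: "'w measure \<Rightarrow> (real \<Rightarrow> 'w \<Rightarrow> config) \<Rightarrow> 'w set" where
  "exit_event M X = {\<omega> \<in> space M. \<exists>t\<ge>0. \<forall>x\<ge>1. X t \<omega> x \<noteq> Second}"

definition rho :: "real \<Rightarrow> nat \<Rightarrow> real" where
  "rho \<alpha> z =
    (if z = 1 then 1 - 1 / (4 * \<alpha>)
     else 1 / 4 ^ z *
       (\<Sum>k = 2..z. (fact (2 * (z - 1) - k) * (real k - 1)) / (fact (z - 1) * fact (z - k))
          * ((1 + real k) * 2 ^ k - 1 / \<alpha> ^ k)))"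

end

theory Submission
  imports Defs
begin

text \<open>
  Compare occupations \<open>\<eta>\<close> and \<open>\<zeta>\<close> through \<open>max\<^sub>y\<^sub>\<ge>\<^sub>0 (N\<^sub>\<eta>(y) + N\<^sub>\<zeta>(y) - y)\<close>, where \<open>N(y)\<close> counts the particles in
  \<open>{1..y}\<close>. Up to a boundary term, the generator of the one-class process acts in the same way on
  both arguments. Averaging over a stationary \<open>\<zeta>\<close> and subtracting the values for \<open>\<eta>\<close> the first class
  particles from those for \<open>\<eta>\<close> all particles gives a function of the two-class configuration that is
  harmonic and equals \<open>1\<close> after the exit. Taking for \<open>\<zeta>\<close> the stationary TASEP on \<open>{1..L}\<close> with
  ejection rate \<open>1\<close> makes it subharmonic everywhere, harmonic as long as the particles stay below
  \<open>L\<close>, and zero once the second class particle is beyond \<open>L\<close>. As that particle cannot stay near the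
  source, the exit probability is the limit, as \<open>L\<close> grows, of the stationary probability that the
  sites \<open>k..l\<close> are all occupied.

  The stationary weights come from the matrix ansatz \<open>DE = D + E\<close>, with \<open>E\<close> and \<open>D\<close> acting on
  polynomials by \<open>p \<mapsto> x p\<close> and \<open>p \<mapsto> (x p - p(1)) / (x - 1)\<close>, right vector \<open>1\<close> and left vector evaluation
  at \<open>1 / \<alpha>\<close>. The limit needs only the growth rate of \<open>((D + E)\<^sup>n 1)(1 / \<alpha>)\<close>, whose coefficients are
  ballot numbers: the relations \<open>DC = DD + C\<close> and \<open>CE = EE + C\<close> for \<open>C = D + E\<close> do the rest.
\<close>

subsection \<open>The matrix ansatz\<close>

definition opE :: "real poly \<Rightarrow> real poly" where "opE p = pCons 0 p"
definition opD :: "real poly \<Rightarrow> real poly" where "opD p = pCons (poly p 1) (synthetic_div p 1)"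
definition opC :: "real poly \<Rightarrow> real poly" where "opC p = opD p + opE p"

text \<open>Multiplication by \<open>x - 1\<close> removes the division hidden in
  \<open>opD\<close>. Identities for \<open>opD\<close> are therefore checked after this
  multiplication and then cancelled.\<close>

lemma opD_times: "[:-1, 1:] * opD p = pCons 0 p - [:poly p 1:]"
proof -
  have "opD p = synthetic_div (pCons 0 p) 1" by (simp add: opD_def)
  then show ?thesis using synthetic_div_correct'[of 1 "pCons 0 p"] by (metis add_diff_cancel_right' mult_zero_left poly_pCons add_0 mult_1)
qed

lemma linear_factor_cancel: "[:-1, 1::real:] * p = [:-1, 1:] * q \<Longrightarrow> p = q"
  by (metis mult_left_cancel pCons_eq_0_iff zero_neq_one)

lemma opD_add: "opD (p + q) = opD p + opD q"
  by (rule linear_factor_cancel) (simp add: opD_times distrib_left del: mult_pCons_left)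

lemma opD_diff: "opD (p - q) = opD p - opD q"
  by (rule linear_factor_cancel) (simp add: opD_times right_diff_distrib del: mult_pCons_left)

lemma opD_smult: "opD (smult a p) = smult a (opD p)"
  by (rule linear_factor_cancel) (simp add: opD_times  smult_diff_right del: mult_pCons_left)

lemma opE_add: "opE (p + q) = opE p + opE q" by (simp add: opE_def)
lemma opE_diff: "opE (p - q) = opE p - opE q" by (simp add: opE_def)
lemma opE_smult: "opE (smult a p) = smult a (opE p)" by (simp add: opE_def)

lemma opD_1 [simp]: "opD 1 = 1" by (simp add: opD_def one_pCons)
lemma poly_opE [simp]: "poly (opE p) x = x * poly p x" by (simp add: opE_def)

text \<open>The relation \<open>DE = D + E\<close>; it makes the bulk terms telescope in
  \<open>wsum_bulk\<close>.\<close>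

lemma opD_opE: "opD (opE p) = opD p + opE p"
  by (rule linear_factor_cancel) (simp add: opD_times distrib_left opE_def del: mult_pCons_left, simp)

lemma opC_add: "opC (p + q) = opC p + opC q" by (simp add: opC_def opD_add opE_add)
lemma opD_opC: "opD (opC p) = opD (opD p) + opC p" by (simp add: opC_def opD_add opD_opE)
lemma opC_opE: "opC (opE p) = opC p + opE (opE p)" by (simp add: opC_def opD_opE)

text \<open>A word stands for an operator product applied to \<open>1\<close>, with
  \<open>opE\<close> for a hole (\<open>False\<close>) and \<open>opD\<close> for a particle
  (\<open>True\<close>). Evaluated at \<open>1 / \<alpha>\<close>, the sum is an unnormalised
  stationary expectation.\<close>

fun wsum :: "nat \<Rightarrow> (bool list \<Rightarrow> real) \<Rightarrow> real poly" where
  "wsum 0 F = [:F []:]"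
| "wsum (Suc n) F = opE (wsum n (\<lambda>w. F (False # w))) + opD (wsum n (\<lambda>w. F (True # w)))"

lemma wsum_add: "wsum n (\<lambda>w. F w + G w) = wsum n F + wsum n G"
  by (induction n arbitrary: F G) (simp_all add: opE_add opD_add)
lemma wsum_diff: "wsum n (\<lambda>w. F w - G w) = wsum n F - wsum n G"
  by (induction n arbitrary: F G) (simp_all add: opE_diff opD_diff)
lemma wsum_smult: "wsum n (\<lambda>w. a * F w) = smult a (wsum n F)"
  by (induction n arbitrary: F) (simp_all add: opE_smult opD_smult smult_add_right)
lemma wsum_0: "wsum n (\<lambda>w. 0) = 0"
  using wsum_smult[of n 0 "\<lambda>_. 0"] by simp
lemma wsum_1: "wsum n (\<lambda>w. 1) = (opC ^^ n) 1"
  by (induction n) (simp_all add: opC_def one_pCons add.commute)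

lemma wsum_cong: "(\<And>w. length w = n \<Longrightarrow> F w = G w) \<Longrightarrow> wsum n F = wsum n G"
proof (induction n arbitrary: F G)
  case (Suc n)
  have "wsum n (\<lambda>w. F (b # w)) = wsum n (\<lambda>w. G (b # w))" for b
    by (rule Suc.IH) (simp add: Suc.prems)
  then show ?case by simp
qed simp

section \<open>Positivity of the stationary weights\<close>

definition nonneg_poly :: "real poly \<Rightarrow> bool" where
  "nonneg_poly p \<longleftrightarrow> (\<forall>i. 0 \<le> coeff p i)"

lemma nonneg_poly_eval: "nonneg_poly p \<Longrightarrow> 0 \<le> x \<Longrightarrow> 0 \<le> poly p x"
  by (simp add: nonneg_poly_def poly_altdef sum_nonneg)

lemma nonneg_poly_pCons: "nonneg_poly (pCons a p) \<longleftrightarrow> 0 \<le> a \<and> nonneg_poly p"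
  unfolding nonneg_poly_def by (auto simp: coeff_pCons split: nat.splits)

text \<open>By Horner's scheme the coefficients of the quotient are values at \<open>1\<close> of
  tails of \<open>p\<close>.\<close>

lemma nonneg_poly_synthetic_div: "nonneg_poly p \<Longrightarrow> nonneg_poly (synthetic_div p 1)"
  by (induction p) (auto simp: nonneg_poly_pCons nonneg_poly_eval)

lemma nonneg_poly_add: "nonneg_poly p \<Longrightarrow> nonneg_poly q \<Longrightarrow> nonneg_poly (p + q)"
  by (simp add: nonneg_poly_def)

lemma nonneg_poly_opE: "nonneg_poly p \<Longrightarrow> nonneg_poly (opE p)"
  by (simp add: opE_def nonneg_poly_pCons)
lemma nonneg_poly_opD: "nonneg_poly p \<Longrightarrow> nonneg_poly (opD p)"
  by (simp add: opD_def nonneg_poly_pCons nonneg_poly_eval nonneg_poly_synthetic_div)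

lemma nonneg_poly_wsum: "(\<And>w. 0 \<le> F w) \<Longrightarrow> nonneg_poly (wsum n F)"
proof (induction n arbitrary: F)
  case 0
  then show ?case by (simp add: nonneg_poly_pCons) (simp add: nonneg_poly_def)
next
  case (Suc n)
  then show ?case by (simp add: nonneg_poly_add nonneg_poly_opE nonneg_poly_opD)
qed

lemma poly_wsum_mono:
  assumes "\<And>w. length w = n \<Longrightarrow> F w \<le> G w" "0 \<le> x"
  shows "poly (wsum n F) x \<le> poly (wsum n G) x"
proof -
  have "0 \<le> poly (wsum n (\<lambda>w. if length w = n then G w - F w else 0)) x"
    by (intro nonneg_poly_eval nonneg_poly_wsum) (use assms in auto)
  also have "wsum n (\<lambda>w. if length w = n then G w - F w else 0) = wsum n (\<lambda>w. G w - F w)"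
    by (rule wsum_cong) simp
  finally show ?thesis by (simp add: wsum_diff)
qed

section \<open>Stationarity under injection at rate \<alpha> and ejection at rate 1\<close>

fun moves :: "bool list \<Rightarrow> bool list list" where
  "moves [] = []"
| "moves [b] = (if b then [[False]] else [])"
| "moves (b # c # w) = (if b \<and> \<not> c then [False # True # w] else []) @ map ((#) b) (moves (c # w))"

definition bulk :: "(bool list \<Rightarrow> real) \<Rightarrow> bool list \<Rightarrow> real" where
  "bulk F w = (\<Sum>z\<leftarrow>moves w. F z - F w)"

lemma bulk_single: "bulk F [b] = (if b then F [False] - F [True] else 0)"
  by (simp add: bulk_def)
lemma bulk_Cons:
  "bulk F (b # c # w) = (if b \<and> \<not> c then F (False # True # w) - F (True # False # w) else 0)
     + bulk (\<lambda>v. F (b # v)) (c # w)"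
  by (auto simp: bulk_def o_def)

text \<open>Each exchange of \<open>DE\<close> shortens the product by one factor, and the shortened
  terms telescope along the word. Ejection closes the sum on the right because
  \<open>D 1 = 1\<close>, so only a term at the first site survives.\<close>

lemma wsum_bulk: "wsum (Suc n) (bulk F) = wsum n (\<lambda>w. F (False # w) - F (True # w))"
proof (induction n arbitrary: F)
  case 0
  have "opD [:a:] = [:a:]" for a using opD_smult[of a 1] by simp
  then show ?case by (simp add: bulk_single opE_def)
next
  case (Suc n)
  have sp: "wsum (Suc (Suc n)) H = opE (wsum (Suc n) (\<lambda>w. H (False # w))) + opD (wsum (Suc n) (\<lambda>w. H (True # w)))" for H
    by simp
  have F: "wsum (Suc n) (\<lambda>w. bulk F (False # w)) = wsum (Suc n) (bulk (\<lambda>v. F (False # v)))"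
    by (rule wsum_cong) (auto simp: length_Suc_conv bulk_Cons)
  \<comment> \<open>The contribution of the first bond. Its weight starts with \<open>DE\<close>,
    which \<open>opD_opE\<close> splits so as to cancel against the two induction
    hypotheses.\<close>
  define g where "g w = (if hd w then 0 else F (False # True # tl w) - F (True # False # tl w))" for w
  have T: "wsum (Suc n) (\<lambda>w. bulk F (True # w)) = wsum (Suc n) (\<lambda>w. g w + bulk (\<lambda>v. F (True # v)) w)"
    by (rule wsum_cong) (auto simp: length_Suc_conv bulk_Cons g_def)
  have g: "wsum (Suc n) g = opE (wsum n (\<lambda>w. F (False # True # w) - F (True # False # w)))"
    using wsum_0 by (simp add: g_def opD_def)
  show ?case
    unfolding sp[of "bulk F"] F T wsum_add g Suc.IH opD_add opD_opE
    by (simp add: wsum_diff opD_diff opE_diff)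
qed

fun injection :: "(bool list \<Rightarrow> real) \<Rightarrow> bool list \<Rightarrow> real" where
  "injection F (False # w) = F (True # w) - F (False # w)"
| "injection F w = 0"

text \<open>At \<open>1 / \<alpha>\<close> a leading \<open>opE\<close> is the factor
  \<open>1 / \<alpha>\<close>, so injection at rate \<alpha> cancels the term left over by
  \<open>wsum_bulk\<close>.\<close>

lemma wsum_stationary:
  assumes "\<alpha> \<noteq> 0"
  shows "\<alpha> * poly (wsum (Suc n) (injection F)) (1 / \<alpha>) + poly (wsum (Suc n) (bulk F)) (1 / \<alpha>) = 0"
  unfolding wsum_bulk using assms by (simp add: wsum_0 wsum_diff opD_def)

subsection \<open>Duality\<close>

definition swp :: "nat \<Rightarrow> (nat \<Rightarrow> 'a) \<Rightarrow> nat \<Rightarrow> 'a" where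
  "swp x \<eta> = \<eta>(x := \<eta> (Suc x), Suc x := \<eta> x)"

text \<open>The recursion computes the maximum of \<open>N\<^sub>\<eta>(y) + N\<^sub>\<zeta>(y) - y\<close> over \<open>y\<close>; sites are numbered from \<open>0\<close> here,
  and beyond the end of the list \<open>\<zeta>\<close> there are holes.\<close>

fun overlap :: "(nat \<Rightarrow> bool) \<Rightarrow> bool list \<Rightarrow> int" where
  "overlap \<eta> [] = 0"
| "overlap \<eta> (b # w) = max 0 (of_bool (\<eta> 0) + of_bool b - 1 + overlap (\<lambda>i. \<eta> (Suc i)) w)"

lemma overlap_nonneg: "0 \<le> overlap \<eta> w"
  by (cases w) auto

lemma overlap_cong: "(\<And>i. i < length w \<Longrightarrow> \<eta> i = \<eta>' i) \<Longrightarrow> overlap \<eta> w = overlap \<eta>' w"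
proof (induction w arbitrary: \<eta> \<eta>')
  case (Cons b w)
  have "overlap (\<lambda>i. \<eta> (Suc i)) w = overlap (\<lambda>i. \<eta>' (Suc i)) w"
    by (rule Cons.IH) (use Cons.prems in auto)
  moreover have "\<eta> 0 = \<eta>' 0" using Cons.prems[of 0] by simp
  ultimately show ?case by simp
qed simp

lemma overlap_mono: "(\<And>i. \<eta> i \<Longrightarrow> \<eta>' i) \<Longrightarrow> overlap \<eta> w \<le> overlap \<eta>' w"
proof (induction w arbitrary: \<eta> \<eta>')
  case (Cons b w)
  have "overlap (\<lambda>i. \<eta> (Suc i)) w \<le> overlap (\<lambda>i. \<eta>' (Suc i)) w"
    by (rule Cons.IH) (use Cons.prems in auto)
  moreover have "of_bool (\<eta> 0) \<le> (of_bool (\<eta>' 0) :: int)" using Cons.prems[of 0] by simp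
  ultimately show ?case unfolding overlap.simps by (intro max.mono) linarith+
qed simp

lemma overlap_add_particle: "\<not> \<eta> x \<Longrightarrow> overlap (\<eta>(x := True)) w \<le> overlap \<eta> w + 1"
proof (induction w arbitrary: \<eta> x)
  case (Cons b w)
  show ?case
  proof (cases x)
    case 0
    then have e: "(\<lambda>i. (\<eta>(x := True)) (Suc i)) = (\<lambda>i. \<eta> (Suc i))" by auto
    show ?thesis using 0 Cons.prems by (simp add: e[simplified 0])
  next
    case (Suc y)
    then have e: "(\<lambda>i. (\<eta>(x := True)) (Suc i)) = (\<lambda>i. \<eta> (Suc i))(y := True)" by auto
    show ?thesis using Cons.IH[of "\<lambda>i. \<eta> (Suc i)" y] Cons.prems Suc by (simp add: e[simplified Suc])
  qed
qed simp

lemma max_drop: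
  fixes r :: int
  shows "r' = r \<or> r' = r - 1 \<Longrightarrow> max 0 (a + r') = max 0 (a + r) \<or> max 0 (a + r') = max 0 (a + r) - 1"
  by (auto simp: max_def)

text \<open>A move lowers \<open>N(y)\<close> by one at a single \<open>y\<close> (the last one for
  an ejection), so the maximum drops by at most one.\<close>

lemma overlap_moves: "z \<in> set (moves w) \<Longrightarrow> overlap \<eta> z = overlap \<eta> w \<or> overlap \<eta> z = overlap \<eta> w - 1"
proof (induction w arbitrary: \<eta> z rule: moves.induct)
  case (3 b c w)
  show ?case
  proof (cases "z = False # True # w \<and> b \<and> \<not> c")
    case True
    then show ?thesis using overlap_nonneg[of "\<lambda>i. \<eta> (Suc (Suc i))" w] by (auto simp: max_def of_bool_def)
  next
    case False
    with 3(2) obtain v where v: "v \<in> set (moves (c # w))" "z = b # v" by (auto split: if_splits)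
    show ?thesis unfolding v(2) overlap.simps(2)[of _ b] by (rule max_drop) (rule 3(1)[OF v(1)])
  qed
qed (auto simp: max_def of_bool_def split: if_splits)

lemma overlap_swp: "\<eta> x \<Longrightarrow> \<not> \<eta> (Suc x) \<Longrightarrow> overlap (swp x \<eta>) w = overlap \<eta> w \<or> overlap (swp x \<eta>) w = overlap \<eta> w - 1"
proof (induction x arbitrary: \<eta> w)
  case 0
  show ?case
  proof (cases w)
    case (Cons b v)
    have "(\<lambda>i. swp 0 \<eta> (Suc (Suc i))) = (\<lambda>i. \<eta> (Suc (Suc i)))" by (auto simp: swp_def)
    then show ?thesis using 0 overlap_nonneg[of "\<lambda>i. \<eta> (Suc (Suc i))" "tl v"]
      by (cases v) (auto simp: Cons swp_def of_bool_def max_def)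
  qed simp
next
  case (Suc x)
  show ?case
  proof (cases w)
    case (Cons b v)
    have "(\<lambda>i. swp (Suc x) \<eta> (Suc i)) = swp x (\<lambda>i. \<eta> (Suc i))" "swp (Suc x) \<eta> 0 = \<eta> 0" by (auto simp: swp_def)
    then show ?thesis using Suc.IH[of "\<lambda>i. \<eta> (Suc i)" v] Suc.prems
      by (auto simp: Cons max_def)
  qed simp
qed

text \<open>The defect of the duality due to \<^const>\<open>moves\<close> ejecting from the last site of the list, while the
  other argument lives on the half-line.\<close>

fun excess :: "(nat \<Rightarrow> bool) \<Rightarrow> bool list \<Rightarrow> bool" where
  "excess \<eta> [] = False"
| "excess \<eta> [b] = (b \<and> \<eta> 0 \<and> \<eta> 1)"
| "excess \<eta> (b # c # w) = (1 \<le> of_bool (\<eta> 0) + of_bool b - 1 + overlap (\<lambda>i. \<eta> (Suc i)) (c # w)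
      \<and> excess (\<lambda>i. \<eta> (Suc i)) (c # w))"

lemma excess_mono: "(\<And>i. \<eta> i \<Longrightarrow> \<eta>' i) \<Longrightarrow> excess \<eta> w \<Longrightarrow> excess \<eta>' w"
proof (induction \<eta> w arbitrary: \<eta>' rule: excess.induct)
  case (3 \<eta> b c w)
  have "overlap (\<lambda>i. \<eta> (Suc i)) (c # w) \<le> overlap (\<lambda>i. \<eta>' (Suc i)) (c # w)"
    by (rule overlap_mono) (use 3 in auto)
  moreover have "of_bool (\<eta> 0) \<le> (of_bool (\<eta>' 0) :: int)" using 3(2)[of 0] by simp
  moreover have "excess (\<lambda>i. \<eta>' (Suc i)) (c # w)" using 3 by auto
  ultimately show ?case using 3(3) unfolding excess.simps by linarith
qed auto

lemma excess_last: "excess \<eta> w \<Longrightarrow> \<eta> (length w)"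
  by (induction \<eta> w rule: excess.induct) auto

text \<open>The outer \<open>max 0\<close> transmits a drop by one exactly when its argument was at
  least \<open>1\<close>. This indicator does not depend on which of the two arguments has
  moved.\<close>

lemma max_shift:
  fixes r :: int assumes "r' = r \<or> r' = r - 1"
  shows "real_of_int (max 0 (a + r')) - real_of_int (max 0 (a + r)) = of_bool (1 \<le> a + r) * (real_of_int r' - real_of_int r)"
  using assms by (auto simp: max_def)

lemma bulk_overlap_Cons:
  "bulk (\<lambda>v. real_of_int (overlap \<eta> (b # v))) w
    = of_bool (1 \<le> of_bool (\<eta> 0) + of_bool b - 1 + overlap (\<lambda>i. \<eta> (Suc i)) w)
      * bulk (\<lambda>v. real_of_int (overlap (\<lambda>i. \<eta> (Suc i)) v)) w"
  unfolding bulk_def sum_list_const_mult[symmetric]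
  by (intro arg_cong[of _ _ sum_list] map_cong refl, unfold overlap.simps, rule max_shift, rule overlap_moves)

definition bonds :: "(nat \<Rightarrow> bool) \<Rightarrow> nat set" where
  "bonds \<eta> = {x. \<eta> x \<and> \<not> \<eta> (Suc x)}"

lemma finite_bonds: "finite {x. \<eta> x} \<Longrightarrow> finite (bonds \<eta>)"
  by (rule finite_subset[of _ "{x. \<eta> x}"]) (auto simp: bonds_def)

lemma bonds_Suc: "bonds \<eta> = (if \<eta> 0 \<and> \<not> \<eta> 1 then {0} else {}) \<union> Suc ` bonds (\<lambda>i. \<eta> (Suc i))"
proof (rule set_eqI)
  fix x show "x \<in> bonds \<eta> \<longleftrightarrow> x \<in> (if \<eta> 0 \<and> \<not> \<eta> 1 then {0} else {}) \<union> Suc ` bonds (\<lambda>i. \<eta> (Suc i))"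
    by (cases x) (auto simp: bonds_def)
qed

text \<open>Induction on the list: the first bonds of the two arguments contribute equally, and all
  other bonds acquire the same indicator from \<open>max_shift\<close>. Only the right end, where
  one side ejects and the other jumps, breaks the symmetry.\<close>

lemma overlap_bulk_duality:
  assumes "finite {x. \<eta> x}"
  shows "(\<Sum>x\<in>bonds \<eta>. real_of_int (overlap (swp x \<eta>) w) - real_of_int (overlap \<eta> w))
     = bulk (\<lambda>v. real_of_int (overlap \<eta> v)) w + of_bool (excess \<eta> w)"
  using assms
proof (induction \<eta> w rule: excess.induct)
  case (1 \<eta>)
  then show ?case by (simp add: bulk_def)
next
  case (2 \<eta> b)
  have s: "finite (bonds \<eta>)" using 2 by (rule finite_bonds)
  \<comment> \<open>For one letter only the jump out of site \<open>0\<close> matters. Ejection has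
    the same effect but is not prevented by a particle at site \<open>1\<close>; this discrepancy is
    \<open>excess\<close>.\<close>
  have "(\<Sum>x\<in>bonds \<eta>. real_of_int (overlap (swp x \<eta>) [b]) - real_of_int (overlap \<eta> [b]))
     = (\<Sum>x\<in>bonds \<eta>. if x = 0 then - of_bool b else 0)"
    by (rule sum.cong) (auto simp: swp_def bonds_def of_bool_def intro!: gr0I)
  also have "\<dots> = (if 0 \<in> bonds \<eta> then - of_bool b else 0)"
    using s by simp
  finally show ?case by (auto simp: bulk_single bonds_def)
next
  case (3 \<eta> b c w)
  let ?\<sigma> = "\<lambda>i. \<eta> (Suc i)"
  let ?a = "of_bool (\<eta> 0) + of_bool b - 1 :: int"
  let ?I = "of_bool (1 \<le> ?a + overlap ?\<sigma> (c # w)) :: real"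
  have fs: "finite {x. ?\<sigma> x}" using 3(2) finite_vimageI[of "{x. \<eta> x}" Suc] by (simp add: vimage_def)
  have fb: "finite (bonds ?\<sigma>)" using fs by (rule finite_bonds)
  have e1: "(\<Sum>x\<in>Suc ` bonds ?\<sigma>. real_of_int (overlap (swp x \<eta>) (b # c # w)) - real_of_int (overlap \<eta> (b # c # w)))
     = ?I * (\<Sum>x\<in>bonds ?\<sigma>. real_of_int (overlap (swp x ?\<sigma>) (c # w)) - real_of_int (overlap ?\<sigma> (c # w)))"
    unfolding sum_distrib_left
  proof (subst sum.reindex, simp, unfold o_def, rule sum.cong[OF refl])
    fix x assume x: "x \<in> bonds ?\<sigma>"
    have "(\<lambda>i. swp (Suc x) \<eta> (Suc i)) = swp x ?\<sigma>" "swp (Suc x) \<eta> 0 = \<eta> 0" by (auto simp: swp_def)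
    then show "real_of_int (overlap (swp (Suc x) \<eta>) (b # c # w)) - real_of_int (overlap \<eta> (b # c # w))
       = ?I * (real_of_int (overlap (swp x ?\<sigma>) (c # w)) - real_of_int (overlap ?\<sigma> (c # w)))"
      unfolding overlap.simps(2)[of _ b]
      using max_shift[OF overlap_swp[of ?\<sigma> x "c # w"]] x by (simp add: bonds_def del: overlap.simps)
  qed
  \<comment> \<open>Both sides vanish unless both arguments start with a particle followed by a hole
    and the remaining overlap is \<open>0\<close>; then both are \<open>-1\<close>.\<close>
  have e2: "(\<Sum>x\<in>(if \<eta> 0 \<and> \<not> \<eta> 1 then {0} else {}). real_of_int (overlap (swp x \<eta>) (b # c # w)) - real_of_int (overlap \<eta> (b # c # w)))
     = (if b \<and> \<not> c then real_of_int (overlap \<eta> (False # True # w)) - real_of_int (overlap \<eta> (True # False # w)) else 0)"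
  proof -
    have "(\<lambda>i. swp 0 \<eta> (Suc (Suc i))) = (\<lambda>i. \<eta> (Suc (Suc i)))" by (auto simp: swp_def)
    then show ?thesis using overlap_nonneg[of "\<lambda>i. \<eta> (Suc (Suc i))" w]
      by (auto simp: swp_def of_bool_def max_def)
  qed
  have "(\<Sum>x\<in>bonds \<eta>. real_of_int (overlap (swp x \<eta>) (b # c # w)) - real_of_int (overlap \<eta> (b # c # w)))
    = (if b \<and> \<not> c then real_of_int (overlap \<eta> (False # True # w)) - real_of_int (overlap \<eta> (True # False # w)) else 0)
      + ?I * (bulk (\<lambda>v. real_of_int (overlap ?\<sigma> v)) (c # w) + of_bool (excess ?\<sigma> (c # w)))"
    unfolding 3(1)[OF fs, symmetric]
    unfolding e1[symmetric] e2[symmetric]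
    by (subst bonds_Suc, rule sum.union_disjoint) (auto simp: fb)
  then show ?case
    unfolding bulk_Cons bulk_overlap_Cons excess.simps(3) by (simp add: distrib_left of_bool_conj del: overlap.simps)
qed

text \<open>The overlap sees the first site only through the total number of particles there. If
  exactly one argument is empty there, its injection adds exactly one, which the indicators account
  for.\<close>

lemma overlap_boundary_duality:
  assumes "w \<noteq> []"
  shows "of_bool (\<not> \<eta> 0) * (real_of_int (overlap (\<eta>(0 := True)) w) - real_of_int (overlap \<eta> w))
     = of_bool (\<not> \<eta> 0) - of_bool (\<not> hd w) + injection (\<lambda>v. real_of_int (overlap \<eta> v)) w"
proof -
  obtain b v where w: "w = b # v" using assms by (cases w) auto
  show ?thesis using overlap_nonneg[of "\<lambda>i. \<eta> (Suc i)" v]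
    by (cases b; cases "\<eta> 0") (auto simp: w max_def)
qed

subsection \<open>Growth of the partition function\<close>

lemma opC_times: "[:-1, 1:] * opC p = pCons 0 (pCons 0 p) - [:poly p 1:]"
  unfolding opC_def distrib_left opD_times by (simp add: opE_def)

lemma coeff_opC_0: "coeff (opC p) 0 = poly p 1"
  by (simp add: opC_def opD_def opE_def)

text \<open>Indexed by \<open>d = n - j\<close> for the coefficient of \<open>x^j\<close> in
  \<open>C^n 1\<close>; \<open>ballot d 0\<close> is the Catalan number of index
  \<open>d\<close>.\<close>

definition ballot :: "nat \<Rightarrow> nat \<Rightarrow> real" where
  "ballot d j = real (j + 1) * fact (2 * d + j) / (fact (d + j + 1) * fact d)"

lemma ballot_pos: "0 < ballot d j" by (simp add: ballot_def)

lemma ballot_Suc_left: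
  "ballot (Suc d) j * ((real d + real j + 2) * (real d + 1)) = ballot d j * ((2 * real d + real j + 2) * (2 * real d + real j + 1))"
  by (simp add: ballot_def divide_simps add_ac)

lemma ballot_0_left: "ballot 0 j = 1" by (simp add: ballot_def)
lemma ballot_0_right: "ballot (Suc d) 0 = ballot d 1"
  by (simp add: ballot_def divide_simps)
lemma ballot_rec: "ballot (Suc d) (Suc i) = ballot d (Suc (Suc i)) + ballot (Suc d) i"
  by (simp add: ballot_def divide_simps) (simp add: algebra_simps)

definition cpow :: "nat \<Rightarrow> real poly" where "cpow n = (opC ^^ n) 1"

lemma cpow_0 [simp]: "cpow 0 = 1" by (simp add: cpow_def)
lemma cpow_Suc: "cpow (Suc n) = opC (cpow n)" by (simp add: cpow_def)

lemma coeff_cpow: "coeff (cpow n) j = (if j \<le> n then ballot (n - j) j else 0)"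
proof (induction n arbitrary: j)
  case 0
  then show ?case by (simp add: ballot_0_left)
next
  case (Suc n)
  define Q where "Q = Poly (map (\<lambda>j. ballot (Suc n - j) j) [0..<n+2])"
  have cQ: "coeff Q j = (if j \<le> Suc n then ballot (Suc n - j) j else 0)" for j
    by (auto simp: Q_def nth_default_def simp del: upt_Suc)
  \<comment> \<open>The defect of the candidate \<open>Q\<close> in \<open>opC_times\<close>. The
    ballot recursion kills its coefficients of positive index, and the root at \<open>1\<close> then
    kills the constant one.\<close>
  define R where "R = [:-1, 1:] * Q - (pCons 0 (pCons 0 (cpow n)) - [:poly (cpow n) 1:])"
  have R1: "poly R 1 = 0" by (simp add: R_def)
  have "coeff R i = 0" if i: "i \<noteq> 0" for i
  proof -
    obtain i' where i': "i = Suc i'" using i by (cases i) auto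
    show ?thesis
    proof (cases i')
      case 0
      then show ?thesis using i' by (cases n) (simp_all add: R_def cQ ballot_0_left ballot_0_right)
    next
      case (Suc a)
      consider "a < n" | "a = n" | "n < a" by linarith
      then show ?thesis
      proof cases
        case 1
        then obtain d where d: "n = Suc (a + d)" by (metis less_imp_Suc_add)
        show ?thesis using ballot_rec[of d a] Suc.IH[of a] by (simp add: R_def cQ i' Suc d)
      qed (simp_all add: R_def cQ i' Suc Suc.IH ballot_0_left)
    qed
  qed
  then have R: "R = [:coeff R 0:]" by (auto simp: poly_eq_iff coeff_pCons split: nat.splits)
  have "poly R 1 = coeff R 0" by (subst R) simp
  with R R1 have "R = 0" by simp
  then have "[:-1, 1:] * Q = [:-1, 1:] * cpow (Suc n)"
    unfolding R_def cpow_Suc opC_times by simp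
  then have "cpow (Suc n) = Q" using linear_factor_cancel by metis
  then show ?case by (simp add: cQ)
qed

lemma poly_altdef_le: "degree p \<le> n \<Longrightarrow> poly p x = (\<Sum>i\<le>n. coeff p i * x ^ i)" for x :: real
  unfolding poly_altdef by (rule sum.mono_neutral_left) (auto simp: coeff_eq_0)

lemma degree_cpow: "degree (cpow n) \<le> n"
  by (rule degree_le) (simp add: coeff_cpow)

lemma poly_cpow: "poly (cpow n) y = (\<Sum>j\<le>n. ballot (n - j) j * y ^ j)"
  unfolding poly_altdef_le[OF degree_cpow] by (rule sum.cong) (auto simp: coeff_cpow)

lemma cpow_pos: "0 < y \<Longrightarrow> 0 < poly (cpow n) y"
  unfolding poly_cpow by (rule sum_pos) (auto intro: mult_pos_pos ballot_pos)

lemma cpow_mono: "0 \<le> x \<Longrightarrow> x \<le> y \<Longrightarrow> poly (cpow n) x \<le> poly (cpow n) y"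
  unfolding poly_cpow by (intro sum_mono mult_left_mono power_mono less_imp_le[OF ballot_pos])

lemma poly_cpow_Suc: "(y - 1) * poly (cpow (Suc n)) y = y\<^sup>2 * poly (cpow n) y - poly (cpow n) 1"
  using arg_cong[OF opC_times[of "cpow n"], of "\<lambda>p. poly p y"]
  by (simp add: cpow_Suc algebra_simps power2_eq_square)

text \<open>By \<open>coeff_opC_0\<close> the value at \<open>1\<close> is the constant coefficient
  of the next power, hence a Catalan number; this is the Catalan recursion.\<close>

lemma cpow_1_rec: "(real n + 3) * poly (cpow (Suc n)) 1 = (4 * real n + 6) * poly (cpow n) 1"
proof -
  have "poly (cpow m) 1 = ballot (Suc m) 0" for m
    using coeff_opC_0[of "cpow m"] by (simp add: cpow_Suc[symmetric] coeff_cpow)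
  moreover have "(real n + 2) * ((real n + 3) * ballot (Suc (Suc n)) 0) = (real n + 2) * ((4 * real n + 6) * ballot (Suc n) 0)"
    using ballot_Suc_left[of "Suc n" 0] by (simp add: algebra_simps)
  moreover have "real n + 2 \<noteq> 0" by linarith
  ultimately show ?thesis by (metis mult_left_cancel)
qed

text \<open>With \<open>cpow_mono\<close> this makes the value at \<open>1\<close> negligible
  against the value at any \<open>y\<close> from \<open>2\<close> on, so the last term of
  \<open>poly_cpow_Suc\<close> disappears in the limit.\<close>

lemma cpow_1_2: "(real n + 2) * poly (cpow n) 1 = 2 * poly (cpow n) 2"
proof (induction n)
  case (Suc n)
  have "2 * poly (cpow (Suc n)) 2 = 8 * poly (cpow n) 2 - 2 * poly (cpow n) 1"
    using poly_cpow_Suc[of 2 n] by simp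
  also have "\<dots> = (4 * real n + 6) * poly (cpow n) 1" using Suc.IH by (simp add: algebra_simps)
  finally show ?case using cpow_1_rec[of n] by (simp add: algebra_simps)
qed simp

lemma cpow_ratio_ge_2:
  assumes "2 \<le> y"
  shows "(\<lambda>n. poly (cpow (Suc n)) y / poly (cpow n) y) \<longlonglongrightarrow> y\<^sup>2 / (y - 1)"
proof -
  have b: "0 \<le> poly (cpow n) 1 / poly (cpow n) y \<and> poly (cpow n) 1 / poly (cpow n) y \<le> 2 / (real n + 2)" for n
  proof -
    have "poly (cpow n) 1 * (real n + 2) \<le> 2 * poly (cpow n) y"
      using cpow_1_2[of n] cpow_mono[of 2 y n] assms by (simp add: mult.commute)
    then show ?thesis using cpow_pos[of y n] cpow_pos[of 1 n] assms by (simp add: divide_simps mult.commute)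
  qed
  have "(\<lambda>n. poly (cpow n) 1 / poly (cpow n) y) \<longlonglongrightarrow> 0"
    by (rule tendsto_sandwich[of "\<lambda>_. 0" _ _ "\<lambda>n. 2 / (real n + 2)"]) (use b in auto, real_asymp)
  then have "(\<lambda>n. (y\<^sup>2 - poly (cpow n) 1 / poly (cpow n) y) / (y - 1)) \<longlonglongrightarrow> (y\<^sup>2 - 0) / (y - 1)"
    by (intro tendsto_intros) (use assms in auto)
  moreover have "(y\<^sup>2 - poly (cpow n) 1 / poly (cpow n) y) / (y - 1) = poly (cpow (Suc n)) y / poly (cpow n) y" for n
    using poly_cpow_Suc[of y n] cpow_pos[of y n] assms by (simp add: divide_simps mult.commute)
  ultimately show ?thesis by simp
qed

text \<open>Already true coefficientwise: by \<open>ballot_Suc_left\<close> the claim for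
  \<open>x^j\<close> reduces to \<open>j^2 - j + 2d + 2\<close> being nonnegative.\<close>

lemma cpow_ratio_lower:
  assumes "0 < y"
  shows "4 * real n / (real n + 2) * poly (cpow n) y \<le> poly (cpow (Suc n)) y"
proof -
  have "4 * real n / (real n + 2) * (ballot (n - j) j * y ^ j) \<le> ballot (Suc n - j) j * y ^ j" if "j \<le> n" for j
  proof -
    define d where "d = n - j"
    have n: "n = d + j" using that by (simp add: d_def)
    have r: "ballot (Suc d) j = ballot d j * ((2 * real d + real j + 2) * (2 * real d + real j + 1)) / ((real n + 2) * (real d + 1))"
      using ballot_Suc_left[of d j] by (subst eq_divide_eq) (simp add: n add_ac)
    have j2: "real j \<le> real j * real j" by (cases j) auto
    have "4 * real n / (real n + 2) \<le> (2 * real d + real j + 2) * (2 * real d + real j + 1) / ((real n + 2) * (real d + 1))"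
      by (simp add: divide_simps) (use j2 in \<open>simp add: n algebra_simps\<close>)
    then have "4 * real n / (real n + 2) * ballot d j \<le> ballot (Suc d) j"
      unfolding r using mult_left_mono[OF _ less_imp_le[OF ballot_pos[of d j]]] by (fastforce simp: mult.commute)
    then have "4 * real n / (real n + 2) * ballot d j * y ^ j \<le> ballot (Suc d) j * y ^ j"
      using assms by (intro mult_right_mono) auto
    then show ?thesis using that by (simp only: mult.assoc d_def Suc_diff_le)
  qed
  then have "4 * real n / (real n + 2) * poly (cpow n) y \<le> (\<Sum>j\<le>n. ballot (Suc n - j) j * y ^ j)"
    unfolding poly_cpow sum_distrib_left by (intro sum_mono) auto
  also have "\<dots> \<le> poly (cpow (Suc n)) y"
    unfolding poly_cpow using assms ballot_pos[of 0 "Suc n"] by simp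
  finally show ?thesis .
qed

text \<open>The coefficients of \<open>C^(n+1) 1 - 4 C^n 1\<close> change sign once, from
  nonpositive to nonnegative. So a negative value at \<open>y = 2\<close> forces a nonpositive value
  at every smaller positive \<open>y\<close>.\<close>

lemma cpow_ratio_upper:
  assumes "0 < y" "y \<le> 2"
  shows "poly (cpow (Suc n)) y \<le> 4 * poly (cpow n) y"
proof -
  define t where "t j = coeff (cpow (Suc n)) j - 4 * coeff (cpow n) j" for j
  have eq: "poly (cpow (Suc n)) x - 4 * poly (cpow n) x = (\<Sum>j\<le>Suc n. t j * x ^ j)" for x
    unfolding poly_altdef_le[OF degree_cpow[of "Suc n"]] poly_altdef_le[OF le_SucI[OF degree_cpow[of n]]] t_def
    by (simp only: left_diff_distrib sum_subtractf sum_distrib_left mult.assoc)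
  \<comment> \<open>The place of the sign change: for \<open>j \<le> n\<close>,
    \<open>ballot_Suc_left\<close> gives \<open>t j\<close> the sign of
    \<open>j * j + 5 * j - (6 * n + 6)\<close>.\<close>
  define j0 where "j0 = (LEAST j. 6 * n + 6 \<le> j * j + 5 * j)"
  have j0: "6 * n + 6 \<le> j0 * j0 + 5 * j0"
    unfolding j0_def by (rule LeastI[of _ "n + 1"]) simp
  have sgn: "(6 * n + 6 \<le> j * j + 5 * j \<longrightarrow> 0 \<le> t j) \<and> (j * j + 5 * j < 6 * n + 6 \<longrightarrow> t j \<le> 0)" if "j \<le> Suc n" for j
  proof (cases "j = Suc n")
    case True
    then show ?thesis by (simp add: t_def coeff_cpow ballot_0_left)
  next
    case False
    define d where "d = n - j"
    have n: "n = d + j" using that False by (simp add: d_def)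
    have tj: "t j = ballot (Suc d) j - 4 * ballot d j" by (simp add: t_def coeff_cpow n)
    have "t j * ((real d + real j + 2) * (real d + 1)) = ballot d j * (real (j * j + 5 * j) - real (6 * n + 6))"
      unfolding tj left_diff_distrib ballot_Suc_left by (simp add: n algebra_simps)
    then have "t j = ballot d j / ((real d + real j + 2) * (real d + 1)) * (real (j * j + 5 * j) - real (6 * n + 6))"
      by (subst times_divide_eq_left, subst eq_divide_eq) (simp add: n add_eq_0_iff)
    moreover have "0 < ballot d j / ((real d + real j + 2) * (real d + 1))" by (simp add: ballot_pos)
    ultimately show ?thesis
      by (metis diff_ge_0_iff_ge diff_le_0_iff_le less_imp_le mult_nonneg_nonneg mult_nonneg_nonpos of_nat_le_iff)
  qed
  have "t j * y ^ j \<le> (y / 2) ^ j0 * (t j * 2 ^ j)" if j: "j \<le> Suc n" for j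
  proof -
    have e: "t j * y ^ j = (y / 2) ^ j * (t j * 2 ^ j)" by (simp add: power_divide)
    show ?thesis
    proof (cases "j < j0")
      case True
      then have "j * j + 5 * j < 6 * n + 6" unfolding j0_def using not_less_Least by fastforce
      then have "t j * 2 ^ j \<le> 0" using sgn[OF j] by (simp add: mult_nonpos_nonneg)
      moreover have "(y / 2) ^ j0 \<le> (y / 2) ^ j" using True assms by (intro power_decreasing) auto
      ultimately show ?thesis unfolding e by (intro mult_right_mono_neg)
    next
      case False
      then have "6 * n + 6 \<le> j * j + 5 * j" using j0 by (meson add_mono linorder_not_le mult_le_mono order_trans le_refl)
      then have "0 \<le> t j * 2 ^ j" using sgn[OF j] by simp
      moreover have "(y / 2) ^ j \<le> (y / 2) ^ j0" using False assms by (intro power_decreasing) auto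
      ultimately show ?thesis unfolding e by (intro mult_right_mono)
    qed
  qed
  then have "(\<Sum>j\<le>Suc n. t j * y ^ j) \<le> (y / 2) ^ j0 * (\<Sum>j\<le>Suc n. t j * 2 ^ j)"
    unfolding sum_distrib_left by (intro sum_mono) auto
  also have "(\<Sum>j\<le>Suc n. t j * 2 ^ j) = - poly (cpow n) 1"
    unfolding eq[symmetric] using poly_cpow_Suc[of 2 n] by simp
  finally have "(\<Sum>j\<le>Suc n. t j * y ^ j) \<le> 0"
    using cpow_pos[of 1 n] assms by (simp add: mult_nonneg_nonneg order_trans)
  then show ?thesis unfolding eq[symmetric] by simp
qed

lemma cpow_ratio_le_2:
  assumes "0 < y" "y \<le> 2"
  shows "(\<lambda>n. poly (cpow (Suc n)) y / poly (cpow n) y) \<longlonglongrightarrow> 4"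
proof (rule tendsto_sandwich[of "\<lambda>n. 4 * real n / (real n + 2)" _ _ "\<lambda>_. 4"])
  show "\<forall>\<^sub>F n in sequentially. 4 * real n / (real n + 2) \<le> poly (cpow (Suc n)) y / poly (cpow n) y"
    using cpow_ratio_lower[OF assms(1)] cpow_pos[OF assms(1)] by (simp add: pos_le_divide_eq)
  show "\<forall>\<^sub>F n in sequentially. poly (cpow (Suc n)) y / poly (cpow n) y \<le> 4"
    using cpow_ratio_upper[OF assms] cpow_pos[OF assms(1)] by (simp add: pos_divide_le_eq)
qed (real_asymp | simp)+

subsection \<open>Limits of the block probabilities\<close>

lemma ratio_shift:
  fixes z :: "nat \<Rightarrow> real"
  assumes pos: "\<And>n. 0 < z n" and lim: "(\<lambda>n. z (Suc n) / z n) \<longlonglongrightarrow> \<kappa>"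
  shows "(\<lambda>N. z (N + n) / z N) \<longlonglongrightarrow> \<kappa> ^ n"
proof (induction n)
  case 0
  have "z N / z N = 1" for N using pos[of N] by simp
  then show ?case by simp
next
  case (Suc n)
  have "(\<lambda>N. z (Suc N + n) / z (Suc N) * (z (Suc N) / z N)) \<longlonglongrightarrow> \<kappa> ^ n * \<kappa>"
    by (intro tendsto_mult lim LIMSEQ_Suc[OF Suc])
  moreover have "z (Suc N + n) / z (Suc N) * (z (Suc N) / z N) = z (N + Suc n) / z N" for N
    using pos[of "Suc N"] by simp
  ultimately show ?case by (simp add: mult.commute)
qed

text \<open>The limits of \<open>(C\<^sup>n E\<^sup>p C\<^sup>N 1)(y) / (C\<^sup>N 1)(y)\<close> as \<open>N\<close> grows, where \<open>\<kappa>\<close> is the growth rate of the denominator.\<close>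

fun hgrid :: "real \<Rightarrow> real \<Rightarrow> nat \<Rightarrow> nat \<Rightarrow> real" where
  "hgrid \<kappa> y 0 p = y ^ p"
| "hgrid \<kappa> y (Suc n) 0 = \<kappa> ^ Suc n"
| "hgrid \<kappa> y (Suc n) (Suc p) = hgrid \<kappa> y n (Suc (Suc p)) + hgrid \<kappa> y (Suc n) p"

lemma opC_pow_add: "(opC ^^ n) (p + q) = (opC ^^ n) p + (opC ^^ n) q"
  by (induction n) (simp_all add: opC_add)

lemma opC_pow_opE: "(opC ^^ Suc n) ((opE ^^ Suc p) r) = (opC ^^ n) ((opE ^^ Suc (Suc p)) r) + (opC ^^ Suc n) ((opE ^^ p) r)"
  by (simp only: funpow_Suc_right o_def funpow_swap1[of opE, symmetric] funpow.simps opC_opE opC_pow_add add.commute)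

lemma opC_pow_cpow: "(opC ^^ n) (cpow N) = cpow (n + N)"
  by (simp add: cpow_def funpow_add)

lemma poly_opE_pow: "poly ((opE ^^ p) r) y = y ^ p * poly r y"
  by (induction p) simp_all

lemma hgrid_limit:
  assumes y: "0 < y" and lim: "(\<lambda>n. poly (cpow (Suc n)) y / poly (cpow n) y) \<longlonglongrightarrow> \<kappa>"
  shows "(\<lambda>N. poly ((opC ^^ n) ((opE ^^ p) (cpow N))) y / poly (cpow N) y) \<longlonglongrightarrow> hgrid \<kappa> y n p"
proof (induction \<kappa> y n p rule: hgrid.induct[of "\<lambda>\<kappa> y n p. 0 < y \<longrightarrow> (\<lambda>n. poly (cpow (Suc n)) y / poly (cpow n) y) \<longlonglongrightarrow> \<kappa> \<longrightarrow>
     (\<lambda>N. poly ((opC ^^ n) ((opE ^^ p) (cpow N))) y / poly (cpow N) y) \<longlonglongrightarrow> hgrid \<kappa> y n p", THEN mp, THEN mp])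
  case (1 \<kappa> y p)
  then show ?case using cpow_pos[of y] by (auto simp: poly_opE_pow less_imp_neq[symmetric])
next
  case (2 \<kappa> y n)
  then show ?case using ratio_shift[of "\<lambda>n. poly (cpow n) y" \<kappa> "Suc n"] cpow_pos[of y]
    by (simp only: opC_pow_cpow funpow.simps(1) id_def hgrid.simps add.commute[of "Suc n"]) simp
next
  case (3 \<kappa> y n p)
  then show ?case unfolding opC_pow_opE poly_add add_divide_distrib hgrid.simps by (auto intro!: tendsto_add)
qed (use assms in auto)

lemma opD_cpow: "opD (cpow N) = cpow (Suc N) - opE (cpow N)"
  by (simp add: cpow_Suc opC_def)

lemma opC_pow_diff: "(opC ^^ n) (p - q) = (opC ^^ n) p - (opC ^^ n) q"
  using opC_pow_add[of n "p - q" q] by simp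

text \<open>By \<open>DC = DD + C\<close>, two factors \<open>D\<close> are traded for one more
  factor \<open>C\<close> on the right. In the limit this factor contributes the growth rate, whence
  the recursion for \<open>f\<close> below.\<close>

lemma opD_pow_rec: "(opD ^^ Suc (Suc m)) (cpow N) = (opD ^^ Suc m) (cpow (Suc N)) - (opD ^^ m) (cpow (Suc N))"
proof -
  have "opD (opD (cpow N)) = opD (cpow (Suc N)) - cpow (Suc N)"
    by (simp add: cpow_Suc opD_opC)
  moreover have "(opD ^^ m) (p - q) = (opD ^^ m) p - (opD ^^ m) q" for p q
    by (induction m) (simp_all add: opD_diff)
  ultimately show ?thesis by (simp only: funpow_Suc_right o_def)
qed

lemma block_limit:
  assumes y: "0 < y" and lim: "(\<lambda>n. poly (cpow (Suc n)) y / poly (cpow n) y) \<longlonglongrightarrow> \<kappa>"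
    and f0: "f 0 = \<kappa> ^ j" and f1: "f (Suc 0) = \<kappa> ^ Suc j - hgrid \<kappa> y j 1"
    and f2: "\<And>m. f (Suc (Suc m)) = \<kappa> * (f (Suc m) - f m)"
  shows "(\<lambda>N. poly ((opC ^^ j) ((opD ^^ m) (cpow N))) y / poly (cpow N) y) \<longlonglongrightarrow> f m"
proof (induction m rule: induct_nat_012)
  case 0
  show ?case using hgrid_limit[OF y lim, of j 0] by (cases j) (auto simp: f0)
next
  case 1
  have "(\<lambda>N. poly ((opC ^^ Suc j) ((opE ^^ 0) (cpow N))) y / poly (cpow N) y - poly ((opC ^^ j) ((opE ^^ 1) (cpow N))) y / poly (cpow N) y)
      \<longlonglongrightarrow> hgrid \<kappa> y (Suc j) 0 - hgrid \<kappa> y j 1"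
    by (intro tendsto_diff hgrid_limit y lim)
  then show ?case unfolding f1
    by (simp add: opD_cpow opC_pow_diff diff_divide_distrib cpow_Suc funpow_swap1)
next
  case (ge2 m)
  define a where "a m N = poly ((opC ^^ j) ((opD ^^ m) (cpow N))) y" for m N
  define z where "z N = poly (cpow N) y" for N
  have nz: "z N \<noteq> 0" for N using cpow_pos[OF y, of N] by (simp add: z_def)
  have "(\<lambda>N. z (Suc N) / z N * (a (Suc m) (Suc N) / z (Suc N) - a m (Suc N) / z (Suc N))) \<longlonglongrightarrow> \<kappa> * (f (Suc m) - f m)"
    using ge2 lim unfolding a_def[symmetric] z_def[symmetric]
    by (intro tendsto_mult tendsto_diff LIMSEQ_Suc)
  moreover have "z (Suc N) / z N * (a (Suc m) (Suc N) / z (Suc N) - a m (Suc N) / z (Suc N)) = a (Suc (Suc m)) N / z N" for N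
    unfolding a_def[of "Suc (Suc m)"] opD_pow_rec opC_pow_diff poly_diff a_def[symmetric] using nz by (simp add: field_simps)
  ultimately show ?case unfolding f2 a_def[symmetric] z_def[symmetric] by (simp only:)
qed

text \<open>The quotient is the stationary probability, on \<open>j + m + N\<close> sites, that the
  \<open>m\<close> sites after the first \<open>j\<close> are all occupied.\<close>

lemma block_probability_limit:
  assumes y: "0 < y" and lim: "(\<lambda>n. poly (cpow (Suc n)) y / poly (cpow n) y) \<longlonglongrightarrow> \<kappa>" and "0 < \<kappa>"
    and "f 0 = \<kappa> ^ j" and "f (Suc 0) = \<kappa> ^ Suc j - hgrid \<kappa> y j 1"
    and "\<And>m. f (Suc (Suc m)) = \<kappa> * (f (Suc m) - f m)"
  shows "(\<lambda>N. poly ((opC ^^ j) ((opD ^^ m) (cpow N))) y / poly (cpow (j + m + N)) y) \<longlonglongrightarrow> f m / \<kappa> ^ (j + m)"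
proof -
  have "(\<lambda>N. poly ((opC ^^ j) ((opD ^^ m) (cpow N))) y / poly (cpow N) y / (poly (cpow (N + (j + m))) y / poly (cpow N) y)) \<longlonglongrightarrow> f m / \<kappa> ^ (j + m)"
    by (intro tendsto_divide block_limit ratio_shift assms cpow_pos) (use assms in auto)
  moreover have "poly (cpow N) y \<noteq> 0" for N using cpow_pos[OF y, of N] by simp
  ultimately show ?thesis by (simp add: add.commute)
qed

text \<open>For \<open>y > 1\<close> the hypothesis says \<open>\<kappa> = y^2 / (y - 1)\<close>,
  the growth rate found for \<open>y\<close> from \<open>2\<close> on.\<close>

lemma hgrid_geometric:
  assumes "\<kappa> * y = y\<^sup>2 + \<kappa>"
  shows "hgrid \<kappa> y n p = \<kappa> ^ n * y ^ p"
  using assms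
proof (induction \<kappa> y n p rule: hgrid.induct)
  case (3 \<kappa> y n p)
  have "hgrid \<kappa> y (Suc n) (Suc p) = \<kappa> ^ n * y ^ p * (y\<^sup>2 + \<kappa>)"
    using 3 by (simp add: algebra_simps power2_eq_square)
  also have "\<dots> = \<kappa> ^ Suc n * y ^ Suc p" unfolding 3(3)[symmetric] by simp
  finally show ?case .
qed auto

text \<open>With vanishing boundary values \<open>H n 0\<close>, the step from row \<open>n\<close> to row \<open>n + 1\<close> of the
  recursion, read off from column \<open>2\<close> on, is the transpose of \<^term>\<open>opC\<close>.\<close>

lemma homogeneous_grid:
  fixes H :: "nat \<Rightarrow> nat \<Rightarrow> real"
  assumes rec: "\<And>n p. H (Suc n) (Suc p) = H n (Suc (Suc p)) + H (Suc n) p"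
    and zero: "\<And>n. H n 0 = 0"
  shows "H (Suc n) 1 = (\<Sum>j\<le>n. ballot (n - j) j * H 0 (j + 2))"
proof -
  \<comment> \<open>Pairs a polynomial with row \<open>m\<close> of \<open>H\<close> from column
    \<open>2\<close> on; the cutoff \<open>N\<close> is immaterial beyond the degree.\<close>
  define \<phi> where "\<phi> m N p = (\<Sum>j<N. coeff p j * H m (j + 2))" for m N p
  have \<phi>_pCons: "\<phi> m (Suc N) (pCons a p) = a * H m 2 + (\<Sum>j<N. coeff p j * H m (j + 3))" for m N a p
    unfolding \<phi>_def by (subst sum.lessThan_Suc_shift) (simp add: numeral_eq_Suc)
  have \<phi>_add: "\<phi> m N (p + q) = \<phi> m N p + \<phi> m N q" for m N p q
    by (simp add: \<phi>_def distrib_right sum.distrib)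
  have opC_smult: "opC (smult a p) = smult a (opC p)" for a p
    by (simp add: opC_def opD_smult opE_smult smult_add_right)
  have opC_const: "opC [:a:] = [:a, a:]" for a
  proof -
    have "opC 1 = [:1, 1:]" by (simp add: opC_def opE_def) (simp add: one_pCons)
    then show ?thesis using opC_smult[of a 1] by simp
  qed
  have \<phi>_mono: "\<phi> m N p = \<phi> m N' p" if "degree p < N" "degree p < N'" for m N N' p
    unfolding \<phi>_def by (rule sum.mono_neutral_cong) (use that in \<open>auto simp: coeff_eq_0\<close>)
  \<comment> \<open>The transposition itself, by induction over \<open>p = a + x q\<close> from
    \<open>CE = EE + C\<close> and \<open>C 1 = 1 + x\<close>.\<close>
  have step: "\<phi> m (N + 2) (opC p) = \<phi> (Suc m) (N + 2) p" if "degree p < N" for m N p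
    using that
  proof (induction p arbitrary: N)
    case 0
    then show ?case using opC_smult[of 0 0] by (simp add: \<phi>_def)
  next
    case (pCons a p)
    show ?case
    proof (cases "p = 0")
      case True
      have "opC (pCons a p) = [:a, a:]" using True opC_const by simp
      moreover have "(\<Sum>j<Suc N. coeff [:a:] j * H m (j + 3)) = a * H m 3"
        by (subst sum.lessThan_Suc_shift) simp
      moreover have "H (Suc m) 2 = H m 2 + H m 3"
        using rec[of m 0] rec[of m 1] by (simp add: zero numeral_eq_Suc)
      ultimately show ?thesis using True \<phi>_pCons[of m "Suc N" a "[:a:]"] \<phi>_pCons[of "Suc m" "Suc N" a 0]
        by (simp add: algebra_simps)
    next
      case False
      then obtain N' where N: "N = Suc N'" and N': "degree p < N'"
        using pCons.prems by (cases N) auto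
      have e: "pCons a p = [:a:] + opE p" by (simp add: opE_def)
      have "opC (pCons a p) = opC [:a:] + (opC p + opE (opE p))"
        by (simp only: e opC_add opC_opE)
      moreover note opC_const[of a]
      moreover have "\<phi> m (N + 2) [:a, a:] = a * H (Suc m) 2"
      proof -
        have "(\<Sum>j<Suc N. coeff [:a:] j * H m (j + 3)) = a * H m 3"
          by (subst sum.lessThan_Suc_shift) simp
        moreover have "H (Suc m) 2 = H m 2 + H m 3"
          using rec[of m 0] rec[of m 1] by (simp add: zero numeral_eq_Suc)
        ultimately show ?thesis using \<phi>_pCons[of m "Suc N" a "[:a:]"] by (simp add: algebra_simps)
      qed
      moreover have "\<phi> m (N + 2) (opC p) = \<phi> (Suc m) (Suc N) p"
        using pCons.IH[of N] N' N \<phi>_mono[of p "N + 2" "Suc N" "Suc m"] by simp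
      moreover have "\<phi> m (N + 2) (opE (opE p)) = (\<Sum>j<N. coeff p j * H m (j + 4))"
        unfolding opE_def by (simp add: \<phi>_pCons sum.lessThan_Suc_shift del: sum.lessThan_Suc) (simp add: numeral_eq_Suc)
      moreover have "\<phi> (Suc m) (N + 2) (pCons a p) = a * H (Suc m) 2 + (\<Sum>j<Suc N. coeff p j * (H m (j + 4) + H (Suc m) (j + 2)))"
        using \<phi>_pCons[of "Suc m" "Suc N" a p] rec by (simp add: numeral_eq_Suc)
      ultimately show ?thesis using N' N
        by (simp add: \<phi>_add distrib_left sum.distrib) (simp add: \<phi>_def coeff_eq_0)
    qed
  qed
  \<comment> \<open>Transposing \<open>m\<close> times descends \<open>m\<close> rows and builds up
    \<open>C^m 1\<close>, whose coefficients are ballot numbers.\<close>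
  have gen: "\<phi> (i + m) (m + 3) (cpow 0) = \<phi> i (m + 3) (cpow m)" for i m
  proof (induction m arbitrary: i)
    case (Suc m)
    have d: "degree (cpow m) < Suc (Suc m)" using degree_cpow[of m] by simp
    have "\<phi> (i + Suc m) (Suc m + 3) (cpow 0) = \<phi> (Suc i + m) (m + 3) (cpow 0)"
      using \<phi>_mono[of "cpow 0" "Suc m + 3" "m + 3"] by simp
    also have "\<dots> = \<phi> (Suc i) (m + 3) (cpow m)" by (rule Suc)
    also have "\<dots> = \<phi> (Suc i) (Suc (Suc m) + 2) (cpow m)"
      using degree_cpow[of m] by (intro \<phi>_mono) auto
    also have "\<dots> = \<phi> i (Suc (Suc m) + 2) (cpow (Suc m))"
      unfolding cpow_Suc by (rule step[OF d, symmetric])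
    finally show ?case by (simp add: numeral_eq_Suc)
  qed simp
  have "H (Suc n) 1 = H n 2" using rec[of n 0] by (simp add: zero numeral_eq_Suc)
  also have "\<dots> = \<phi> (0 + n) (n + 3) (cpow 0)"
    using \<phi>_pCons[of n "n + 2" 1 0] by (simp add: one_pCons numeral_eq_Suc)
  also have "\<dots> = \<phi> 0 (n + 3) (cpow n)" by (rule gen)
  also have "\<dots> = (\<Sum>j\<in>{..n}. ballot (n - j) j * H 0 (j + 2))"
    unfolding \<phi>_def by (rule sum.mono_neutral_cong_right) (auto simp: coeff_cpow)
  finally show ?thesis .
qed

text \<open>With \<open>k = j + 2\<close> and \<open>z = n + 2\<close> the factorials in
  \<open>rho\<close> form a ballot number.\<close>

lemma rho_Suc_Suc:
  "4 ^ (n + 2) * rho \<alpha> (n + 2) = (\<Sum>j\<le>n. ballot (n - j) j * ((real j + 3) * 2 ^ (j + 2) - (1 / \<alpha>) ^ (j + 2)))"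
proof -
  have "4 ^ (n + 2) * rho \<alpha> (n + 2) = (\<Sum>k = 0 + 2..n + 2. (fact (2 * (n + 1) - k) * (real k - 1)) / (fact (n + 1) * fact (n + 2 - k))
          * ((1 + real k) * 2 ^ k - 1 / \<alpha> ^ k))"
    unfolding add_0 by (simp add: rho_def del: sum.cl_ivl_Suc)
  also have "\<dots> = (\<Sum>j\<le>n. ballot (n - j) j * ((real j + 3) * 2 ^ (j + 2) - (1 / \<alpha>) ^ (j + 2)))"
    unfolding sum.shift_bounds_cl_nat_ivl atMost_atLeast0
  proof (rule sum.cong[OF refl], goal_cases)
    case (1 j)
    then obtain d where d: "n = d + j" by (metis atLeastAtMost_iff le_iff_add add.commute)
    have "2 * (n + 1) - (j + 2) = 2 * d + j" "n + 2 - (j + 2) = d" "n - j = d" by (auto simp: d)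
    then show ?case by (simp add: ballot_def d power_one_over add_ac mult.commute)
  qed
  finally show ?thesis .
qed

text \<open>For growth rate \<open>4\<close> the equation \<open>4 y = y^2 + 4\<close> has the
  double root \<open>2\<close>, so \<open>4^n 2^p\<close> and \<open>4^n p 2^p\<close> both solve
  the recursion of \<open>hgrid\<close>. Subtracting the first from \<open>hgrid\<close> gives zero
  boundary values, and the second has them already. \<open>homogeneous_grid\<close> applies to
  both.\<close>

lemma hgrid_rho:
  assumes "\<alpha> > 0"
  shows "hgrid 4 (1 / \<alpha>) j 1 = 4 ^ Suc j * (1 - rho \<alpha> (Suc j))"
proof (cases j)
  case 0
  then show ?thesis using assms by (simp add: rho_def)
next
  case (Suc n)
  have A: "hgrid 4 (1 / \<alpha>) (Suc n) 1 - 4 ^ Suc n * 2 ^ 1 = (\<Sum>j\<le>n. ballot (n - j) j * (hgrid 4 (1 / \<alpha>) 0 (j + 2) - 4 ^ 0 * 2 ^ (j + 2)))"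
    by (rule homogeneous_grid[of "\<lambda>n p. hgrid 4 (1 / \<alpha>) n p - 4 ^ n * 2 ^ p"])
      (auto simp: algebra_simps, metis hgrid.simps(1,2) not0_implies_Suc power_0 cancel_comm_monoid_add_class.diff_cancel)
  have B: "4 ^ Suc n * real 1 * 2 ^ 1 = (\<Sum>j\<le>n. ballot (n - j) j * (4 ^ 0 * real (j + 2) * 2 ^ (j + 2)))"
    by (rule homogeneous_grid[of "\<lambda>n p. 4 ^ n * real p * 2 ^ p"]) (auto simp: algebra_simps)
  have "4 ^ (n + 2) * rho \<alpha> (n + 2) = (\<Sum>j\<le>n. ballot (n - j) j * (4 ^ 0 * real (j + 2) * 2 ^ (j + 2)))
      - (\<Sum>j\<le>n. ballot (n - j) j * (hgrid 4 (1 / \<alpha>) 0 (j + 2) - 4 ^ 0 * 2 ^ (j + 2)))"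
    unfolding rho_Suc_Suc sum_subtractf[symmetric] by (rule sum.cong) (auto simp: algebra_simps)
  then show ?thesis unfolding A[symmetric] B[symmetric] Suc by (simp add: algebra_simps)
qed

lemma block_probability_max_current:
  assumes "1 / 2 \<le> \<alpha>"
  shows "(\<lambda>N. poly ((opC ^^ j) ((opD ^^ m) (cpow N))) (1 / \<alpha>) / poly (cpow (j + m + N)) (1 / \<alpha>))
    \<longlonglongrightarrow> (1 + (2 * rho \<alpha> (Suc j) - 1) * real m) / 2 ^ m"
proof -
  \<comment> \<open>The recursion has characteristic equation \<open>t^2 = 4 (t - 1)\<close> with
    double root \<open>2\<close>, hence the factor linear in \<open>m\<close>.\<close>
  define f where "f m = 4 ^ j * (2 ^ m * (1 + (2 * rho \<alpha> (Suc j) - 1) * real m))" for m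
  have y: "0 < 1 / \<alpha>" "1 / \<alpha> \<le> 2" and a: "0 < \<alpha>" using assms by (auto simp: field_simps)
  have "(\<lambda>N. poly ((opC ^^ j) ((opD ^^ m) (cpow N))) (1 / \<alpha>) / poly (cpow (j + m + N)) (1 / \<alpha>)) \<longlonglongrightarrow> f m / 4 ^ (j + m)"
    by (rule block_probability_limit[OF y(1) cpow_ratio_le_2[OF y]])
      (unfold hgrid_rho[OF a], auto simp: f_def algebra_simps)
  moreover have "(4::real) ^ m = 2 ^ m * 2 ^ m" by (simp flip: power_mult_distrib)
  ultimately show ?thesis by (simp add: f_def power_add)
qed

lemma block_probability_low_density:
  assumes "0 < \<alpha>" "\<alpha> \<le> 1 / 2"
  shows "(\<lambda>N. poly ((opC ^^ j) ((opD ^^ m) (cpow N))) (1 / \<alpha>) / poly (cpow (j + m + N)) (1 / \<alpha>)) \<longlonglongrightarrow> \<alpha> ^ m"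
proof -
  define \<kappa> where "\<kappa> = 1 / (\<alpha> * (1 - \<alpha>))"
  have y: "2 \<le> 1 / \<alpha>" and a: "\<alpha> \<noteq> 1" using assms by (auto simp: field_simps)
  have \<kappa>: "(1 / \<alpha>)\<^sup>2 / (1 / \<alpha> - 1) = \<kappa>" "0 < \<kappa>" "\<kappa> * (1 / \<alpha>) = (1 / \<alpha>)\<^sup>2 + \<kappa>"
    using assms a by (auto simp: \<kappa>_def field_simps power2_eq_square)
  \<comment> \<open>The roots of \<open>t^2 = \<kappa> (t - 1)\<close> are
    \<open>1 / \<alpha>\<close> and \<open>1 / (1 - \<alpha>)\<close>; the initial values select the
    second one.\<close>
  define f where "f m = \<kappa> ^ j * (1 / (1 - \<alpha>)) ^ m" for m
  have "(\<lambda>N. poly ((opC ^^ j) ((opD ^^ m) (cpow N))) (1 / \<alpha>) / poly (cpow (j + m + N)) (1 / \<alpha>)) \<longlonglongrightarrow> f m / \<kappa> ^ (j + m)"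
  proof (rule block_probability_limit)
    show "(\<lambda>n. poly (cpow (Suc n)) (1 / \<alpha>) / poly (cpow n) (1 / \<alpha>)) \<longlonglongrightarrow> \<kappa>"
      using cpow_ratio_ge_2[OF y] by (simp only: \<kappa>)
    show "f (Suc 0) = \<kappa> ^ Suc j - hgrid \<kappa> (1 / \<alpha>) j 1"
    proof -
      have "1 / (1 - \<alpha>) = \<kappa> - 1 / \<alpha>" using assms a by (simp add: \<kappa>_def field_simps)
      then have "f (Suc 0) = \<kappa> ^ j * (\<kappa> - 1 / \<alpha>)" by (simp only: f_def power_Suc power_0 mult_1_right)
      then show ?thesis unfolding hgrid_geometric[OF \<kappa>(3)] by (simp add: right_diff_distrib mult.commute)
    qed
    show "f (Suc (Suc i)) = \<kappa> * (f (Suc i) - f i)" for i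
    proof -
      have "1 / (1 - \<alpha>) - 1 = \<alpha> / (1 - \<alpha>)" using a by (simp add: field_simps)
      then have "1 / (1 - \<alpha>) * (1 / (1 - \<alpha>)) = \<kappa> * (1 / (1 - \<alpha>) - 1)" using assms by (simp add: \<kappa>_def)
      then have "\<kappa> ^ j * (1 / (1 - \<alpha>)) ^ i * (1 / (1 - \<alpha>) * (1 / (1 - \<alpha>))) = \<kappa> ^ j * (1 / (1 - \<alpha>)) ^ i * (\<kappa> * (1 / (1 - \<alpha>) - 1))" by simp
      then show ?thesis unfolding f_def by (simp only: power_Suc right_diff_distrib mult_ac mult_1_left mult_1_right)
    qed
  qed (use assms \<kappa> in \<open>auto simp: f_def\<close>)
  moreover have "f m / \<kappa> ^ (j + m) = \<alpha> ^ m"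
  proof -
    have "1 / (1 - \<alpha>) / \<kappa> = \<alpha>" using assms a by (simp add: \<kappa>_def)
    then have "(1 / (1 - \<alpha>)) ^ m / \<kappa> ^ m = \<alpha> ^ m" by (metis power_divide)
    then show ?thesis using \<kappa>(2) by (simp add: f_def power_add)
  qed
  ultimately show ?thesis by simp
qed

subsection \<open>The generator of the two-class process\<close>

definition jumpable :: "config \<Rightarrow> nat set" where
  "jumpable c = {x. 1 \<le> x \<and> label (c x) < label (c (x + 1))}"

definition gen :: "real \<Rightarrow> (config \<Rightarrow> real) \<Rightarrow> config \<Rightarrow> real" where
  "gen \<alpha> F c = (\<Sum>x\<in>jumpable c. F (swap_at x c) - F c)
     + (if c 1 \<noteq> First then \<alpha> * (F (inject c) - F c) else 0)"

definition exited :: "config \<Rightarrow> bool" where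
  "exited c \<longleftrightarrow> (\<forall>x\<ge>1. c x \<noteq> Second)"

text \<open>A transition raises the bound \<open>n\<close> by at most one. The bound controls both
  the total rate and the range in which \<open>exit_fun\<close> is harmonic.\<close>

definition admissible :: "nat \<Rightarrow> config \<Rightarrow> bool" where
  "admissible n c \<longleftrightarrow> (\<forall>x>n. c x = Hole)
     \<and> (\<forall>x\<ge>1. \<forall>y\<ge>1. c x = Second \<longrightarrow> c y = Second \<longrightarrow> x = y)"

lemma label_less_iff: "label a < label b \<longleftrightarrow> a = First \<and> b \<noteq> First \<or> a = Second \<and> b = Hole"
  by (cases a; cases b) (simp_all add: one_less_numeral_iff)

lemma jumpable_iff:
  "x \<in> jumpable c \<longleftrightarrow> 1 \<le> x \<and> (c x = First \<and> c (Suc x) \<noteq> First \<or> c x = Second \<and> c (Suc x) = Hole)"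
  by (simp add: jumpable_def label_less_iff)

lemma jumpable_le: "admissible n c \<Longrightarrow> jumpable c \<subseteq> {1..n}"
  unfolding admissible_def jumpable_iff subset_iff atLeastAtMost_iff by (metis linorder_not_less species.distinct)

lemma finite_jumpable: "admissible n c \<Longrightarrow> finite (jumpable c)"
  using jumpable_le finite_subset by blast

lemma swap_at_apply: "swap_at x c z = c (if z = x then Suc x else if z = Suc x then x else z)"
  by (simp add: swap_at_def)

lemma admissible_swap:
  assumes "admissible n c" "x \<in> jumpable c"
  shows "admissible (Suc n) (swap_at x c)"
  unfolding admissible_def
proof (intro conjI allI impI)
  have x: "x \<le> n" "1 \<le> x" using assms jumpable_le by fastforce+
  show "swap_at x c z = Hole" if "Suc n < z" for z
    using assms(1) x that by (simp add: swap_at_apply admissible_def)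
  show "y = z" if "1 \<le> y" "1 \<le> z" "swap_at x c y = Second" "swap_at x c z = Second" for y z
  proof -
    have "(if y = x then Suc x else if y = Suc x then x else y) = (if z = x then Suc x else if z = Suc x then x else z)"
      using assms(1) that x unfolding swap_at_apply admissible_def by simp
    then show ?thesis by (simp split: if_splits)
  qed
qed

lemma admissible_inject: "admissible n c \<Longrightarrow> admissible (Suc n) (inject c)"
  unfolding admissible_def inject_def by auto

lemma exited_swap:
  assumes "1 \<le> x"
  shows "exited (swap_at x c) \<longleftrightarrow> exited c"
proof -
  have *: "exited (swap_at x c)" if "exited c" for c
    using that assms by (simp add: exited_def swap_at_apply)
  moreover have "swap_at x (swap_at x c) = c"
    by (auto simp: fun_eq_iff swap_at_def)
  ultimately show ?thesis by metis
qed

lemma exited_inject: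
  assumes "admissible n c"
  shows "exited (inject c) \<longleftrightarrow> exited c \<or> c 1 = Second"
proof -
  have u: "y = 1" if "1 \<le> y" "c y = Second" "c 1 = Second" for y
    using assms that unfolding admissible_def by blast
  show ?thesis
  proof
    assume e: "exited (inject c)"
    have "y = 1" if "1 \<le> y" "c y = Second" for y
      using e that unfolding exited_def inject_def by (metis fun_upd_apply)
    then show "exited c \<or> c 1 = Second" unfolding exited_def by blast
  next
    assume "exited c \<or> c 1 = Second"
    then show "exited (inject c)"
      unfolding exited_def inject_def fun_upd_apply using u by (metis species.distinct(1))
  qed
qed

subsection \<open>The subharmonic functions\<close>

definition occ_first :: "config \<Rightarrow> nat \<Rightarrow> bool" where "occ_first c i \<longleftrightarrow> c (Suc i) = First"
definition occ_any :: "config \<Rightarrow> nat \<Rightarrow> bool" where "occ_any c i \<longleftrightarrow> c (Suc i) \<noteq> Hole"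

definition mean :: "real \<Rightarrow> nat \<Rightarrow> (bool list \<Rightarrow> real) \<Rightarrow> real" where
  "mean \<alpha> L F = poly (wsum L F) (1 / \<alpha>) / poly (cpow L) (1 / \<alpha>)"

definition blocked :: "config \<Rightarrow> bool list \<Rightarrow> real" where
  "blocked c w = real_of_int (overlap (occ_any c) w) - real_of_int (overlap (occ_first c) w)"

text \<open>After the exit the two occupations agree and \<open>blocked\<close> vanishes; the
  indicator then supplies the value \<open>1\<close>.\<close>

definition exit_fun :: "real \<Rightarrow> nat \<Rightarrow> config \<Rightarrow> real" where
  "exit_fun \<alpha> L c = of_bool (exited c) + mean \<alpha> L (blocked c)"

lemma mean_add: "mean \<alpha> L (\<lambda>w. F w + G w) = mean \<alpha> L F + mean \<alpha> L G"
  by (simp add: mean_def wsum_add add_divide_distrib)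
lemma mean_diff: "mean \<alpha> L (\<lambda>w. F w - G w) = mean \<alpha> L F - mean \<alpha> L G"
  by (simp add: mean_def wsum_diff diff_divide_distrib)
lemma mean_cmult: "mean \<alpha> L (\<lambda>w. a * F w) = a * mean \<alpha> L F"
  by (simp add: mean_def wsum_smult)
lemma mean_cong: "(\<And>w. length w = L \<Longrightarrow> F w = G w) \<Longrightarrow> mean \<alpha> L F = mean \<alpha> L G"
  unfolding mean_def by (simp cong: wsum_cong)
lemma mean_const: "0 < \<alpha> \<Longrightarrow> mean \<alpha> L (\<lambda>w. a) = a"
  using mean_cmult[of \<alpha> L a "\<lambda>_. 1"] cpow_pos[of "1 / \<alpha>" L] by (simp add: mean_def wsum_1 cpow_def)
lemma mean_sum: "finite A \<Longrightarrow> mean \<alpha> L (\<lambda>w. \<Sum>x\<in>A. F x w) = (\<Sum>x\<in>A. mean \<alpha> L (F x))"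
  by (induction A rule: finite_induct) (simp_all add: mean_add mean_cmult[of \<alpha> L 0 "\<lambda>_. 0", simplified])
lemma mean_mono: "0 < \<alpha> \<Longrightarrow> (\<And>w. length w = L \<Longrightarrow> F w \<le> G w) \<Longrightarrow> mean \<alpha> L F \<le> mean \<alpha> L G"
  unfolding mean_def by (intro divide_right_mono poly_wsum_mono less_imp_le[OF cpow_pos]) auto

lemma mean_stationary:
  assumes "0 < \<alpha>"
  shows "\<alpha> * mean \<alpha> (Suc n) (injection F) + mean \<alpha> (Suc n) (bulk F) = 0"
  using wsum_stationary[of \<alpha> n F] assms unfolding mean_def
  by (simp add: add_divide_distrib[symmetric] del: wsum.simps)

text \<open>Both the first class particles alone and all particles together form a one-class
  process. A swap within one of the two groups of species does not change the projection, and the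
  remaining swaps are its bonds.\<close>

lemma sum_jumpable:
  fixes P :: "species \<Rightarrow> bool"
  defines "occ \<equiv> \<lambda>c i. P (c (Suc i))"
  assumes P: "P First" "\<not> P Hole" and adm: "admissible n c"
  shows "(\<Sum>x\<in>jumpable c. real_of_int (overlap (occ (swap_at x c)) w) - real_of_int (overlap (occ c) w))
    = bulk (\<lambda>v. real_of_int (overlap (occ c) v)) w + of_bool (excess (occ c) w)"
proof -
  have "finite {i. occ c i}"
  proof (rule finite_subset)
    show "{i. occ c i} \<subseteq> {..<n}"
    proof
      fix i assume "i \<in> {i. occ c i}"
      then have "c (Suc i) \<noteq> Hole" using P by (auto simp: occ_def)
      then have "Suc i \<le> n" using adm unfolding admissible_def by (meson linorder_not_le)
      then show "i \<in> {..<n}" by simp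
    qed
  qed simp
  note duality = overlap_bulk_duality[OF this, of w]
  have "(\<Sum>x\<in>jumpable c. real_of_int (overlap (occ (swap_at x c)) w) - real_of_int (overlap (occ c) w))
    = (\<Sum>x\<in>Suc ` bonds (occ c). real_of_int (overlap (occ (swap_at x c)) w) - real_of_int (overlap (occ c) w))"
  proof (rule sum.mono_neutral_right)
    show "Suc ` bonds (occ c) \<subseteq> jumpable c"
    proof (rule image_subsetI)
      fix i assume "i \<in> bonds (occ c)"
      then show "Suc i \<in> jumpable c" using P
        by (cases "c (Suc i)"; cases "c (Suc (Suc i))") (auto simp: bonds_def occ_def jumpable_iff)
    qed
    show "\<forall>x\<in>jumpable c - Suc ` bonds (occ c). real_of_int (overlap (occ (swap_at x c)) w) - real_of_int (overlap (occ c) w) = 0"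
    proof
      fix x assume x: "x \<in> jumpable c - Suc ` bonds (occ c)"
      then obtain y where y: "x = Suc y" by (cases x) (auto simp: jumpable_iff)
      then have "P (c x) \<longleftrightarrow> P (c (Suc x))" using x P
        by (cases "c x"; cases "c (Suc x)") (auto simp: jumpable_iff bonds_def occ_def)
      then have "occ (swap_at x c) = occ c" by (auto simp: occ_def swap_at_def fun_eq_iff)
      then show "real_of_int (overlap (occ (swap_at x c)) w) - real_of_int (overlap (occ c) w) = 0" by simp
    qed
  qed (use adm finite_jumpable in auto)
  also have "\<dots> = (\<Sum>x\<in>bonds (occ c). real_of_int (overlap (swp x (occ c)) w) - real_of_int (overlap (occ c) w))"
  proof -
    have "occ (swap_at (Suc x) c) = swp x (occ c)" for x by (auto simp: occ_def swap_at_def swp_def fun_eq_iff)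
    then show ?thesis by (simp add: sum.reindex)
  qed
  finally show ?thesis unfolding duality .
qed

text \<open>In the difference of the two boundary dualities the terms in \<open>hd w\<close> cancel;
  the indicators of the first site differ exactly for a second class particle.\<close>

lemma blocked_inject:
  assumes "w \<noteq> []"
  shows "of_bool (c 1 \<noteq> First) * (blocked (inject c) w - blocked c w)
    = injection (blocked c) w - of_bool (c 1 = Second)"
proof -
  obtain b v where w: "w = b # v" using assms by (cases w) auto
  have i: "injection (blocked c) w = injection (\<lambda>v. real_of_int (overlap (occ_any c) v)) w - injection (\<lambda>v. real_of_int (overlap (occ_first c) v)) w"
    unfolding w by (cases b) (simp_all add: blocked_def del: overlap.simps)
  have first: "occ_first (inject c) = (occ_first c)(0 := True)" by (auto simp: occ_first_def inject_def fun_eq_iff)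
  have any: "occ_any (inject c) = (occ_any c)(0 := True)" by (auto simp: occ_any_def inject_def fun_eq_iff)
  have same: "(occ_any c)(0 := True) = occ_any c" if "c 1 = Second" using that by (auto simp: occ_any_def fun_eq_iff)
  show ?thesis
    using overlap_boundary_duality[OF assms, of "occ_any c"] overlap_boundary_duality[OF assms, of "occ_first c"]
    unfolding i blocked_def first any
    by (cases "c 1") (simp_all add: same, simp_all add: occ_any_def occ_first_def)
qed

text \<open>The bulk and injection terms cancel by \<open>mean_stationary\<close>, and the loss in
  \<open>blocked_inject\<close> is the gain of the exit indicator. Only the defect of the bulk
  duality remains.\<close>

lemma gen_exit_fun:
  assumes "0 < \<alpha>" and adm: "admissible m c"
  shows "gen \<alpha> (exit_fun \<alpha> (Suc n)) c
    = mean \<alpha> (Suc n) (\<lambda>w. of_bool (excess (occ_any c) w) - of_bool (excess (occ_first c) w))"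
proof -
  let ?E = "mean \<alpha> (Suc n)"
  have fin: "finite (jumpable c)" using adm by (rule finite_jumpable)
  have any: "(\<Sum>x\<in>jumpable c. real_of_int (overlap (occ_any (swap_at x c)) w) - real_of_int (overlap (occ_any c) w))
      = bulk (\<lambda>v. real_of_int (overlap (occ_any c) v)) w + of_bool (excess (occ_any c) w)" for w
    using sum_jumpable[of "\<lambda>s. s \<noteq> Hole", OF _ _ adm] unfolding occ_any_def[abs_def] by blast
  have first: "(\<Sum>x\<in>jumpable c. real_of_int (overlap (occ_first (swap_at x c)) w) - real_of_int (overlap (occ_first c) w))
      = bulk (\<lambda>v. real_of_int (overlap (occ_first c) v)) w + of_bool (excess (occ_first c) w)" for w
    using sum_jumpable[of "\<lambda>s. s = First", OF _ _ adm] unfolding occ_first_def[abs_def] by blast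
  have "(\<Sum>x\<in>jumpable c. exit_fun \<alpha> (Suc n) (swap_at x c) - exit_fun \<alpha> (Suc n) c)
     = ?E (\<lambda>w. \<Sum>x\<in>jumpable c. blocked (swap_at x c) w - blocked c w)"
    unfolding mean_sum[OF fin] mean_diff by (rule sum.cong) (auto simp: exit_fun_def exited_swap jumpable_iff)
  also have "\<dots> = ?E (\<lambda>w. bulk (blocked c) w + (of_bool (excess (occ_any c) w) - of_bool (excess (occ_first c) w)))"
  proof (rule mean_cong)
    fix w
    have "bulk (blocked c) w = bulk (\<lambda>v. real_of_int (overlap (occ_any c) v)) w - bulk (\<lambda>v. real_of_int (overlap (occ_first c) v)) w"
      unfolding bulk_def blocked_def sum_list_subtractf[symmetric] by (simp add: algebra_simps)
    moreover have "(\<Sum>x\<in>jumpable c. blocked (swap_at x c) w - blocked c w)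
      = (\<Sum>x\<in>jumpable c. real_of_int (overlap (occ_any (swap_at x c)) w) - real_of_int (overlap (occ_any c) w))
        - (\<Sum>x\<in>jumpable c. real_of_int (overlap (occ_first (swap_at x c)) w) - real_of_int (overlap (occ_first c) w))"
      unfolding sum_subtractf[symmetric] by (simp add: blocked_def algebra_simps)
    ultimately show "(\<Sum>x\<in>jumpable c. blocked (swap_at x c) w - blocked c w)
       = bulk (blocked c) w + (of_bool (excess (occ_any c) w) - of_bool (excess (occ_first c) w))"
      unfolding any first by simp
  qed
  finally have 1: "(\<Sum>x\<in>jumpable c. exit_fun \<alpha> (Suc n) (swap_at x c) - exit_fun \<alpha> (Suc n) c)
     = ?E (bulk (blocked c)) + ?E (\<lambda>w. of_bool (excess (occ_any c) w) - of_bool (excess (occ_first c) w))"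
    by (simp add: mean_add)
  have "?E (\<lambda>w. of_bool (c 1 \<noteq> First) * (blocked (inject c) w - blocked c w))
     = ?E (\<lambda>w. injection (blocked c) w - of_bool (c 1 = Second))"
    by (rule mean_cong) (rule blocked_inject, auto)
  then have "of_bool (c 1 \<noteq> First) * (?E (blocked (inject c)) - ?E (blocked c)) = ?E (injection (blocked c)) - of_bool (c 1 = Second)"
    unfolding mean_cmult mean_diff mean_const[OF assms(1)] .
  moreover have "of_bool (exited (inject c)) = of_bool (exited c) + (of_bool (c 1 = Second) :: real)"
    unfolding exited_inject[OF adm] by (auto simp: exited_def)
  ultimately have "(if c 1 \<noteq> First then exit_fun \<alpha> (Suc n) (inject c) - exit_fun \<alpha> (Suc n) c else 0) = ?E (injection (blocked c))"
    by (cases "c 1") (auto simp: exit_fun_def)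
  then have 2: "(if c 1 \<noteq> First then \<alpha> * (exit_fun \<alpha> (Suc n) (inject c) - exit_fun \<alpha> (Suc n) c) else 0) = \<alpha> * ?E (injection (blocked c))"
    by (auto split: if_splits)
  show ?thesis unfolding gen_def 1 2 using mean_stationary[OF assms(1), of n "blocked c"] by simp
qed

lemma gen_exit_fun_nonneg:
  assumes "0 < \<alpha>" "admissible m c"
  shows "0 \<le> gen \<alpha> (exit_fun \<alpha> (Suc n)) c"
proof -
  have "mean \<alpha> (Suc n) (\<lambda>_. 0) \<le> gen \<alpha> (exit_fun \<alpha> (Suc n)) c"
    unfolding gen_exit_fun[OF assms]
  proof (rule mean_mono[OF assms(1)])
    fix w
    show "0 \<le> of_bool (excess (occ_any c) w) - (of_bool (excess (occ_first c) w) :: real)"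
      using excess_mono[of "occ_first c" "occ_any c" w] by (auto simp: occ_first_def occ_any_def)
  qed
  then show ?thesis using mean_const[OF assms(1)] by simp
qed

lemma gen_exit_fun_zero:
  assumes "0 < \<alpha>" "admissible m c" "m \<le> Suc n"
  shows "gen \<alpha> (exit_fun \<alpha> (Suc n)) c = 0"
proof -
  have "gen \<alpha> (exit_fun \<alpha> (Suc n)) c = mean \<alpha> (Suc n) (\<lambda>_. 0)"
    unfolding gen_exit_fun[OF assms(1,2)]
  proof (rule mean_cong)
    fix w :: "bool list" assume w: "length w = Suc n"
    \<comment> \<open>This site has index \<open>Suc n\<close> in the numbering from
      \<open>0\<close>; by \<open>excess_last\<close> a positive defect would need a particle
      there.\<close>
    have "c (Suc (Suc n)) = Hole" using assms(2,3) by (auto simp: admissible_def)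
    then have "\<not> excess (occ_any c) w" "\<not> excess (occ_first c) w"
      using excess_last[of "occ_any c" w] excess_last[of "occ_first c" w] by (auto simp: w occ_any_def occ_first_def)
    then show "of_bool (excess (occ_any c) w) - of_bool (excess (occ_first c) w) = (0::real)" by simp
  qed
  then show ?thesis using mean_const[OF assms(1)] by simp
qed

lemma blocked_exited:
  assumes "exited c"
  shows "blocked c w = 0"
proof -
  have "c (Suc i) \<noteq> Second" for i using assms by (simp add: exited_def)
  then have "occ_any c i = occ_first c i" for i
    by (cases "c (Suc i)") (simp_all add: occ_any_def occ_first_def)
  then have "occ_any c = occ_first c" by blast
  then show ?thesis by (simp add: blocked_def)
qed

lemma occ_any_Second:
  assumes "admissible n c" "1 \<le> x" "c x = Second"
  shows "occ_any c = (occ_first c)(x - 1 := True)"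
proof
  fix i
  have "1 \<le> Suc i" by simp
  then have "c (Suc i) = Second \<longleftrightarrow> Suc i = x" using assms unfolding admissible_def by blast
  then show "occ_any c i = ((occ_first c)(x - 1 := True)) i" using assms
    by (cases "c (Suc i)") (auto simp: occ_any_def occ_first_def)
qed

lemma exit_fun_exited: "0 < \<alpha> \<Longrightarrow> exited c \<Longrightarrow> exit_fun \<alpha> L c = 1"
  using mean_const[of \<alpha> L 0] mean_cong[of L "blocked c" "\<lambda>_. 0"] by (simp add: exit_fun_def blocked_exited)

lemma exit_fun_nonneg:
  assumes "0 < \<alpha>"
  shows "of_bool (exited c) \<le> exit_fun \<alpha> L c"
proof -
  have "mean \<alpha> L (\<lambda>_. 0) \<le> mean \<alpha> L (blocked c)"
    by (rule mean_mono[OF assms]) (auto simp: blocked_def occ_first_def occ_any_def intro!: overlap_mono)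
  then show ?thesis using mean_const[OF assms] by (simp add: exit_fun_def)
qed

lemma exit_fun_le:
  assumes "0 < \<alpha>" "admissible n c"
  shows "exit_fun \<alpha> L c \<le> of_bool (exited c) + of_bool (\<exists>x. 1 \<le> x \<and> x \<le> L \<and> c x = Second)"
proof (cases "exited c")
  case True
  then show ?thesis using exit_fun_exited[OF assms(1)] by simp
next
  case False
  then obtain x where x: "1 \<le> x" "c x = Second" by (auto simp: exited_def)
  note any = occ_any_Second[OF assms(2) x]
  have "mean \<alpha> L (blocked c) \<le> mean \<alpha> L (\<lambda>_. of_bool (x \<le> L))"
  proof (rule mean_mono[OF assms(1)])
    fix w :: "bool list" assume w: "length w = L"
    have "\<not> occ_first c (x - 1)" using x by (simp add: occ_first_def)
    then have "overlap (occ_any c) w \<le> overlap (occ_first c) w + 1" unfolding any by (rule overlap_add_particle)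
    moreover have "overlap (occ_any c) w = overlap (occ_first c) w" if "L < x"
      by (rule overlap_cong) (use that in \<open>auto simp: any w\<close>)
    ultimately show "blocked c w \<le> of_bool (x \<le> L)" by (auto simp: blocked_def)
  qed
  also have "\<dots> \<le> of_bool (\<exists>x. 1 \<le> x \<and> x \<le> L \<and> c x = Second)"
    using mean_const[OF assms(1)] x by auto
  finally show ?thesis using False by (simp add: exit_fun_def)
qed

lemma overlap_empty: "overlap (\<lambda>_. False) w = 0"
  by (induction w) (auto simp: of_bool_def)

text \<open>A single particle at \<open>e\<close> overlaps with \<open>w\<close> only if
  \<open>w\<close> is occupied from the first site through \<open>e\<close>: any earlier hole costs
  one and the outer \<open>max\<close> stops at \<open>0\<close>. This gives \<open>e + 1\<close>
  factors \<open>D\<close>.\<close>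

lemma wsum_single_particle:
  "wsum (Suc e + N) (\<lambda>w. real_of_int (overlap (\<lambda>i. i = e) w)) = (opD ^^ Suc e) (cpow N)"
proof (induction e)
  case 0
  have e: "(\<lambda>i. Suc i = 0) = (\<lambda>_. False)" by auto
  show ?case by (simp add: e overlap_empty wsum_0 wsum_1 opE_def cpow_def)
next
  case (Suc e)
  have "overlap (\<lambda>i. i = e) w \<le> 1" for w
  proof -
    have "(\<lambda>i. i = e) = (\<lambda>_. False)(e := True)" by (simp add: fun_eq_iff)
    then show ?thesis using overlap_add_particle[of "\<lambda>_. False" e w] by (simp add: overlap_empty)
  qed
  then have "max 0 (overlap (\<lambda>i. i = e) w - 1) = 0" for w by (simp add: max_def antisym)
  then show ?case using Suc overlap_nonneg[of "\<lambda>i. i = e"] by (simp add: wsum_0 opE_def max_absorb2 del: wsum.simps(2)) (simp add: wsum_0 opE_def max_absorb2)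
qed

text \<open>On a site occupied in both projections the outer \<open>max\<close> is inactive, so the
  difference ignores the letter of \<open>w\<close> there and the site contributes a free factor
  \<open>C\<close>.\<close>

lemma wsum_init:
  "wsum (j + (Suc e + N)) (\<lambda>w. real_of_int (overlap (\<lambda>i. i < j \<or> i = j + e) w) - real_of_int (overlap (\<lambda>i. i < j) w))
    = (opC ^^ j) ((opD ^^ Suc e) (cpow N))"
proof (induction j)
  case 0
  then show ?case using wsum_single_particle[of e N] by (simp add: overlap_empty)
next
  case (Suc j)
  let ?A = "\<lambda>i. i < j \<or> i = j + e" and ?B = "\<lambda>i. i < j"
  have "max 0 (of_bool b + overlap \<eta> w) = of_bool b + overlap \<eta> w" for b \<eta> w
    using overlap_nonneg[of \<eta> w] by (simp add: max_absorb2)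
  then have e: "(\<lambda>w. real_of_int (overlap (\<lambda>i. i < Suc j \<or> i = Suc j + e) (b # w)) - real_of_int (overlap (\<lambda>i. i < Suc j) (b # w)))
      = (\<lambda>w. real_of_int (overlap ?A w) - real_of_int (overlap ?B w))" for b
    by (auto simp: fun_eq_iff)
  have "(opC ^^ Suc j) p = opE ((opC ^^ j) p) + opD ((opC ^^ j) p)" for p
    by (simp add: opC_def[of "(opC ^^ j) p"])
  then show ?case
    unfolding add_Suc wsum.simps(2) e[unfolded add_Suc] Suc.IH[unfolded add_Suc] by metis
qed

lemma exit_fun_init:
  assumes "1 \<le> k" "k \<le> l"
  shows "exit_fun \<alpha> (k - 1 + (l - k + 1) + N) (init_config k l)
    = poly ((opC ^^ (k - 1)) ((opD ^^ (l - k + 1)) (cpow N))) (1 / \<alpha>) / poly (cpow (k - 1 + (l - k + 1) + N)) (1 / \<alpha>)"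
proof -
  define j e where "j = k - 1" and "e = l - k"
  have kl: "k = Suc j" "l = Suc (j + e)" using assms by (auto simp: j_def e_def)
  have "occ_any (init_config k l) = (\<lambda>i. i < j \<or> i = j + e)" "occ_first (init_config k l) = (\<lambda>i. i < j)"
    by (auto simp: occ_any_def occ_first_def init_config_def kl fun_eq_iff)
  moreover have "\<not> exited (init_config k l)"
    using assms by (auto simp: exited_def init_config_def intro!: exI[of _ l])
  ultimately show ?thesis using wsum_init[of j e N]
    by (simp add: exit_fun_def mean_def blocked_def[abs_def] kl add.assoc del: funpow.simps)
qed

subsection \<open>The second class particle does not stay near the source\<close>

text \<open>Every injection, and every swap at a bond to the left of the second class particle, lowers \<open>lag\<close>.
  So a potential \<open>\<theta> ^ lag\<close> with small \<open>\<theta>\<close> outweighs the moves of the second class particle to the right.\<close>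

definition lag :: "config \<Rightarrow> nat \<Rightarrow> nat" where
  "lag c x = x * x - \<Sum>{a \<in> {1..<x}. c a = First}"

definition potential :: "real \<Rightarrow> config \<Rightarrow> real" where
  "potential \<theta> c = (if exited c then 1 else \<theta> ^ lag c (LEAST x. 1 \<le> x \<and> c x = Second))"

text \<open>Ensures that the subtraction of naturals in \<open>lag\<close> is exact, with
  \<open>x\<close> to spare.\<close>

lemma sum_first_le:
  fixes c :: config
  shows "\<Sum>{a \<in> {1..<x}. c a = First} + x \<le> x * x"
proof -
  have "\<Sum>{a \<in> {1..<x}. c a = First} \<le> \<Sum>{1..<x}" by (rule sum_mono2) auto
  also have "\<dots> + x \<le> x * x" by (induction x) (auto simp: atLeastLessThanSuc)
  finally show ?thesis by simp
qed

lemma potential_eq: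
  assumes "admissible n c" "1 \<le> x" "c x = Second"
  shows "potential \<theta> c = \<theta> ^ lag c x"
proof -
  have "(LEAST x. 1 \<le> x \<and> c x = Second) = x"
    by (rule Least_equality) (use assms in \<open>auto simp: admissible_def\<close>)
  then show ?thesis using assms by (auto simp: potential_def exited_def)
qed

lemma potential_bounds: "0 < \<theta> \<Longrightarrow> \<theta> \<le> 1 \<Longrightarrow> 0 < potential \<theta> c \<and> potential \<theta> c \<le> 1"
  by (simp add: potential_def power_le_one)

lemma potential_lower:
  assumes "0 < \<theta>" "\<theta> \<le> 1" "admissible n c" "1 \<le> x" "x \<le> B" "c x = Second"
  shows "\<theta> ^ (B * B) \<le> potential \<theta> c"
proof -
  have "lag c x \<le> B * B" using mult_le_mono[OF assms(5,5)] by (simp add: lag_def)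
  then show ?thesis unfolding potential_eq[OF assms(3,4,6)] using assms by (intro power_decreasing) auto
qed

lemma power_gain:
  fixes \<theta> :: real
  assumes "0 < \<theta>" "\<theta> \<le> 1" "Suc m \<le> n"
  shows "\<theta> ^ n / \<theta> \<le> \<theta> ^ m"
proof -
  have "\<theta> ^ n \<le> \<theta> ^ Suc m" using assms by (intro power_decreasing) auto
  then show ?thesis using assms by (simp add: divide_simps mult.commute)
qed

text \<open>Either the second class particle is overtaken and moves back, or a first class particle
  to its left advances; \<open>lag\<close> falls by at least one in both cases.\<close>

lemma potential_swap_left:
  assumes \<theta>: "0 < \<theta>" "\<theta> \<le> 1" and adm: "admissible n c" and x: "1 \<le> x" "c x = Second"
    and b: "b \<in> jumpable c" "b < x"
  shows "potential \<theta> c / \<theta> \<le> potential \<theta> (swap_at b c)"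
proof -
  have b1: "1 \<le> b" "c b = First" "c (Suc b) \<noteq> First"
    using b x adm unfolding jumpable_iff admissible_def by (metis less_irrefl)+
  note adm' = admissible_swap[OF adm b(1)]
  show ?thesis
  proof (cases "Suc b = x")
    case True
    have "{a \<in> {1..<x}. c a = First} = insert b {a \<in> {1..<b}. swap_at b c a = First}"
      using b1 True by (auto simp: swap_at_def)
    then have s: "\<Sum>{a \<in> {1..<x}. c a = First} = b + \<Sum>{a \<in> {1..<b}. swap_at b c a = First}" by simp
    have "Suc (lag (swap_at b c) b) \<le> lag c x"
      using sum_first_le[where x=b and c="swap_at b c"] unfolding lag_def s by (simp add: True[symmetric])
    moreover have "potential \<theta> (swap_at b c) = \<theta> ^ lag (swap_at b c) b"
      by (rule potential_eq[OF adm' b1(1)]) (use x True in \<open>auto simp: swap_at_def\<close>)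
    ultimately show ?thesis unfolding potential_eq[OF adm x] using \<theta> by (simp add: power_gain)
  next
    case False
    then have bx: "Suc b < x" using b by simp
    have "{a \<in> {1..<x}. swap_at b c a = First} = insert (Suc b) ({a \<in> {1..<x}. c a = First} - {b})"
      using b1 bx by (auto simp: swap_at_def)
    then have "\<Sum>{a \<in> {1..<x}. swap_at b c a = First} = Suc b + \<Sum>({a \<in> {1..<x}. c a = First} - {b})"
      using b1 by simp
    also have "\<Sum>{a \<in> {1..<x}. c a = First} = b + \<Sum>({a \<in> {1..<x}. c a = First} - {b})"
      using b1 bx by (subst sum.remove[of _ b]) auto
    then have "Suc b + \<Sum>({a \<in> {1..<x}. c a = First} - {b}) = Suc (\<Sum>{a \<in> {1..<x}. c a = First})" by simp
    finally have "Suc (lag (swap_at b c) x) \<le> lag c x"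
      using sum_first_le[of x "swap_at b c"] x(1) unfolding lag_def by simp
    moreover have "potential \<theta> (swap_at b c) = \<theta> ^ lag (swap_at b c) x"
      by (rule potential_eq[OF adm' x(1)]) (use x bx in \<open>auto simp: swap_at_def\<close>)
    ultimately show ?thesis unfolding potential_eq[OF adm x] using \<theta> by (simp add: power_gain)
  qed
qed

lemma potential_swap_right:
  assumes adm: "admissible n c" and x: "1 \<le> x" "c x = Second" and b: "b \<in> jumpable c" "x < b"
  shows "potential \<theta> (swap_at b c) = potential \<theta> c"
proof -
  have "potential \<theta> (swap_at b c) = \<theta> ^ lag (swap_at b c) x"
    by (rule potential_eq[OF admissible_swap[OF adm b(1)] x(1)]) (use x b in \<open>auto simp: swap_at_def\<close>)
  moreover have "{a \<in> {1..<x}. swap_at b c a = First} = {a \<in> {1..<x}. c a = First}"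
    using b by (auto simp: swap_at_def)
  ultimately show ?thesis unfolding potential_eq[OF adm x] by (simp add: lag_def)
qed

lemma potential_inject:
  assumes \<theta>: "0 < \<theta>" "\<theta> \<le> 1" and adm: "admissible n c" and x: "1 \<le> x" "c x = Second" and c1: "c 1 \<noteq> First"
  shows "potential \<theta> c / \<theta> \<le> potential \<theta> (inject c)"
proof (cases "x = 1")
  case True
  then have "exited (inject c)" using exited_inject[OF adm] x by simp
  moreover have "lag c 1 = 1" by (simp add: lag_def)
  ultimately show ?thesis using True \<theta> unfolding potential_eq[OF adm x] by (simp add: potential_def)
next
  case False
  then have x1: "1 < x" using x by simp
  have "{a \<in> {1..<x}. inject c a = First} = insert 1 {a \<in> {1..<x}. c a = First}"
    using x1 by (auto simp: inject_def)
  then have "\<Sum>{a \<in> {1..<x}. inject c a = First} = Suc (\<Sum>{a \<in> {1..<x}. c a = First})" using c1 by simp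
  then have "Suc (lag (inject c) x) \<le> lag c x"
    using sum_first_le[of x "inject c"] x(1) unfolding lag_def by simp
  moreover have "potential \<theta> (inject c) = \<theta> ^ lag (inject c) x"
    by (rule potential_eq[OF admissible_inject[OF adm] x(1)]) (use x x1 in \<open>auto simp: inject_def\<close>)
  ultimately show ?thesis unfolding potential_eq[OF adm x] using \<theta> by (simp add: power_gain)
qed

text \<open>Some helpful transition always has rate at least \<open>min 1 \<alpha>\<close>, and by
  the choice of \<theta> it gains at least twice the potential. The only harmful one, the jump of
  the second class particle, loses at most the potential once.\<close>

lemma gen_potential:
  assumes \<alpha>: "0 < \<alpha>" and \<theta>: "0 < \<theta>" "\<theta> \<le> 1" "min 1 \<alpha> * (1 / \<theta> - 1) = 2"
    and adm: "admissible n c" and x: "1 \<le> x" "c x = Second"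
  shows "potential \<theta> c \<le> gen \<alpha> (potential \<theta>) c"
proof -
  let ?V = "potential \<theta> c"
  define g where "g = ?V / \<theta> - ?V"
  have V: "0 < ?V" using potential_bounds[OF \<theta>(1,2)] by simp
  have g: "min 1 \<alpha> * g = 2 * ?V" unfolding g_def using arg_cong[OF \<theta>(3), of "\<lambda>t. ?V * t"] by (simp add: algebra_simps)
  have g0: "0 \<le> g" unfolding g_def using V \<theta> by (simp add: divide_simps)
  have fin: "finite (jumpable c)" using adm by (rule finite_jumpable)
  define A where "A = {b \<in> jumpable c. b < x}"
  have "real (card A) * g - ?V \<le> (\<Sum>b\<in>jumpable c. (if b < x then g else 0) - (if b = x then ?V else 0))"
    unfolding sum_subtractf A_def using fin V by (simp add: sum.If_cases sum.delta Int_def)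
  also have "\<dots> \<le> (\<Sum>b\<in>jumpable c. potential \<theta> (swap_at b c) - ?V)"
  proof (rule sum_mono)
    fix b assume b: "b \<in> jumpable c"
    consider "b < x" | "b = x" | "x < b" by linarith
    then show "(if b < x then g else 0) - (if b = x then ?V else 0) \<le> potential \<theta> (swap_at b c) - ?V"
    proof cases
      case 1
      then show ?thesis using potential_swap_left[OF \<theta>(1,2) adm x b] by (simp add: g_def)
    next
      case 2
      then show ?thesis using potential_bounds[OF \<theta>(1,2)] by (simp add: less_imp_le)
    next
      case 3
      then show ?thesis using potential_swap_right[OF adm x b] by simp
    qed
  qed
  finally have S: "real (card A) * g - ?V \<le> (\<Sum>b\<in>jumpable c. potential \<theta> (swap_at b c) - ?V)" .
  have "2 * ?V \<le> real (card A) * g + (if c 1 \<noteq> First then \<alpha> * g else 0)"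
  proof (cases "c 1 = First")
    case True
    \<comment> \<open>With no bond available before \<open>x\<close>, \<open>First\<close> would
      propagate from site \<open>1\<close> up to \<open>x\<close>.\<close>
    have "A \<noteq> {}"
    proof
      assume A: "A = {}"
      have "c b = First" if "1 \<le> b" "b \<le> x" for b
        using that
      proof (induction b rule: dec_induct)
        case (step b)
        then show ?case using A by (auto simp: A_def jumpable_iff)
      qed (use True in simp)
      then show False using x by (metis order_refl species.distinct(1))
    qed
    then have "1 \<le> card A" using fin by (simp add: A_def Suc_le_eq card_gt_0_iff)
    then have "min 1 \<alpha> * g \<le> real (card A) * g" using g0 by (intro mult_right_mono) auto
    then show ?thesis using g True by simp
  next
    case False
    have "min 1 \<alpha> * g \<le> \<alpha> * g" using g0 by (intro mult_right_mono) auto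
    then show ?thesis using g False g0 by (simp add: add_increasing)
  qed
  moreover have "(if c 1 \<noteq> First then \<alpha> * g else 0) \<le> (if c 1 \<noteq> First then \<alpha> * (potential \<theta> (inject c) - ?V) else 0)"
    using potential_inject[OF \<theta>(1,2) adm x] \<alpha> by (auto simp: g_def)
  ultimately show ?thesis unfolding gen_def using S by linarith
qed

lemma gen_potential_exited:
  assumes "admissible n c" "exited c"
  shows "gen \<alpha> (potential \<theta>) c = 0"
proof -
  have "potential \<theta> (swap_at x c) = potential \<theta> c" if "x \<in> jumpable c" for x
    using that assms by (simp add: potential_def exited_swap jumpable_iff)
  moreover have "potential \<theta> (inject c) = potential \<theta> c" using assms exited_inject[OF assms(1)] by (simp add: potential_def)
  ultimately show ?thesis by (simp add: gen_def)
qed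

subsection \<open>The jump chain\<close>

definition targets :: "config \<Rightarrow> config set" where
  "targets c = insert (inject c) ((\<lambda>x. swap_at x c) ` jumpable c)"

definition total_rate :: "real \<Rightarrow> config \<Rightarrow> real" where
  "total_rate \<alpha> c = real (card (jumpable c)) + (if c 1 \<noteq> First then \<alpha> else 0)"

lemma finite_targets: "admissible n c \<Longrightarrow> finite (targets c)"
  by (simp add: targets_def finite_jumpable)

lemma tasep_rate_alt:
  "tasep_rate \<alpha> c d = real (card {x \<in> jumpable c. d = swap_at x c}) + (if c 1 \<noteq> First \<and> d = inject c then \<alpha> else 0)"
  by (simp add: tasep_rate_def jumpable_def conj_assoc)

text \<open>Regroups the sum over target states into a sum over transitions. If site
  \<open>1\<close> holds \<open>First\<close>, the target \<open>inject c\<close> is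
  \<open>c\<close> itself and has rate \<open>0\<close>.\<close>

lemma tasep_rate_sum:
  assumes "admissible n c"
  shows "(\<Sum>d\<in>targets c. tasep_rate \<alpha> c d * F d) = gen \<alpha> F c + total_rate \<alpha> c * F c"
proof -
  note fin = finite_jumpable[OF assms] finite_targets[OF assms]
  have "(\<Sum>d\<in>targets c. real (card {x \<in> jumpable c. d = swap_at x c}) * F d)
      = (\<Sum>d\<in>targets c. \<Sum>x\<in>{x \<in> jumpable c. swap_at x c = d}. F (swap_at x c))"
  proof (rule sum.cong[OF refl])
    fix d
    have "(\<Sum>x\<in>{x \<in> jumpable c. swap_at x c = d}. F (swap_at x c)) = (\<Sum>x\<in>{x \<in> jumpable c. swap_at x c = d}. F d)"
      by (rule sum.cong) auto
    then show "real (card {x \<in> jumpable c. d = swap_at x c}) * F d = (\<Sum>x\<in>{x \<in> jumpable c. swap_at x c = d}. F (swap_at x c))"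
      by (simp add: eq_commute[of d])
  qed
  also have "\<dots> = (\<Sum>x\<in>jumpable c. F (swap_at x c))"
    by (rule sum.group) (use fin in \<open>auto simp: targets_def\<close>)
  finally have 1: "(\<Sum>d\<in>targets c. real (card {x \<in> jumpable c. d = swap_at x c}) * F d) = (\<Sum>x\<in>jumpable c. F (swap_at x c))" .
  have "(\<Sum>d\<in>targets c. (if c 1 \<noteq> First \<and> d = inject c then \<alpha> else 0) * F d)
     = (\<Sum>d\<in>targets c. if d = inject c then (if c 1 \<noteq> First then \<alpha> * F (inject c) else 0) else 0)"
    by (rule sum.cong) auto
  also have "\<dots> = (if c 1 \<noteq> First then \<alpha> * F (inject c) else 0)"
    using fin(2) by (simp add: sum.delta targets_def)
  finally show ?thesis
    unfolding tasep_rate_alt distrib_right sum.distrib 1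
    by (simp add: gen_def total_rate_def sum_subtractf algebra_simps)
qed

lemma exit_rate_tasep:
  assumes "admissible n c"
  shows "exit_rate (tasep_rate \<alpha>) c = total_rate \<alpha> c"
proof -
  have "tasep_rate \<alpha> c d = 0" if "d \<notin> targets c" for d
  proof -
    have e: "{x \<in> jumpable c. d = swap_at x c} = {}" and "d \<noteq> inject c" using that by (auto simp: targets_def)
    then show ?thesis unfolding tasep_rate_alt e by simp
  qed
  then have "exit_rate (tasep_rate \<alpha>) c = (\<Sum>\<^sub>\<infinity>d\<in>targets c. tasep_rate \<alpha> c d)"
    unfolding exit_rate_def by (intro infsum_cong_neutral) auto
  also have "\<dots> = (\<Sum>d\<in>targets c. tasep_rate \<alpha> c d * 1)"
    using finite_targets[OF assms] by simp
  finally show ?thesis unfolding tasep_rate_sum[OF assms] by (simp add: gen_def)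
qed

text \<open>A leading \<open>First\<close> must be followed somewhere by a swappable bond, since
  there are holes far out. The linear upper bound leads to the harmonic series in
  \<open>lingering_small\<close>.\<close>

lemma total_rate_bounds:
  assumes "0 < \<alpha>" "admissible n c"
  shows "0 < total_rate \<alpha> c" "total_rate \<alpha> c \<le> real n + \<alpha>"
proof -
  show "0 < total_rate \<alpha> c"
  proof (cases "c 1 = First")
    case True
    have "jumpable c \<noteq> {}"
    proof
      assume A: "jumpable c = {}"
      have "c b = First" if "1 \<le> b" for b
        using that
      proof (induction b rule: dec_induct)
        case (step b)
        then show ?case using A jumpable_iff[of b c] by auto
      qed (use True in simp)
      then have "c (Suc n) = First" by simp
      then show False using assms(2) by (auto simp: admissible_def)
    qed
    then show ?thesis using finite_jumpable[OF assms(2)] True by (simp add: total_rate_def card_gt_0_iff)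
  qed (use assms in \<open>simp add: total_rate_def add_nonneg_pos\<close>)
  have "card (jumpable c) \<le> n" using card_mono[OF _ jumpable_le[OF assms(2)]] by simp
  then show "total_rate \<alpha> c \<le> real n + \<alpha>" using assms(1) by (simp add: total_rate_def)
qed

lemma admissible_targets:
  assumes "admissible n c" "d \<in> targets c"
  shows "admissible (Suc n) d" "exited c \<Longrightarrow> exited d"
proof -
  consider "d = inject c" | x where "x \<in> jumpable c" "d = swap_at x c"
    using assms(2) unfolding targets_def by blast
  then have "admissible (Suc n) d \<and> (exited c \<longrightarrow> exited d)"
  proof cases
    case 1
    then show ?thesis using assms(1) by (simp add: admissible_inject exited_inject)
  next
    case 2
    then show ?thesis using admissible_swap[OF assms(1) 2(1)] exited_swap[of x c] by (simp add: jumpable_iff)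
  qed
  then show "admissible (Suc n) d" "exited c \<Longrightarrow> exited d" by auto
qed

text \<open>A history lists the visited states in reverse order.\<close>

fun histories :: "config \<Rightarrow> nat \<Rightarrow> config list set" where
  "histories c0 0 = {[c0]}"
| "histories c0 (Suc n) = (\<Union>h\<in>histories c0 n. (\<lambda>d. d # h) ` targets (hd h))"

lemma histories_props:
  assumes "admissible m c0" "h \<in> histories c0 n"
  shows "length h = Suc n \<and> admissible (m + n) (hd h) \<and> (exited (hd h) \<longleftrightarrow> (\<exists>c\<in>set h. exited c))"
  using assms(2)
proof (induction n arbitrary: h)
  case 0
  then show ?case using assms(1) by simp
next
  case (Suc n)
  then obtain g d where h: "g \<in> histories c0 n" "d \<in> targets (hd g)" "h = d # g" by auto
  note IH = Suc.IH[OF h(1)]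
  then have adm: "admissible (m + n) (hd g)" by simp
  note adm_d = admissible_targets[OF adm h(2)]
  then show ?case using IH h adm_d by auto
qed

lemma finite_histories: "admissible m c0 \<Longrightarrow> finite (histories c0 n)"
proof (induction n)
  case (Suc n)
  have "finite (targets (hd h))" if "h \<in> histories c0 n" for h
    using histories_props[OF Suc.prems that] finite_targets by blast
  then show ?case using Suc by simp
qed simp

locale tasep_jump_chain = prob_space M for M :: "'w measure" +
  fixes \<alpha> :: real and c0 :: config and m0 :: nat
    and Y :: "nat \<Rightarrow> 'w \<Rightarrow> config" and S :: "nat \<Rightarrow> 'w \<Rightarrow> real"
  assumes \<alpha>: "0 < \<alpha>" and adm0: "admissible m0 c0"
    and Y_meas [measurable]: "\<And>n. Y n \<in> measurable M (count_space UNIV)"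
    and Y0: "\<And>\<omega>. \<omega> \<in> space M \<Longrightarrow> Y 0 \<omega> = c0"
    and S_pos: "\<And>n \<omega>. \<omega> \<in> space M \<Longrightarrow> 0 < S n \<omega>"
    and law: "jump_chain_law M (tasep_rate \<alpha>) Y S"
begin

definition cylinder :: "config list \<Rightarrow> 'w set" where
  "cylinder h = {\<omega> \<in> space M. \<forall>i<length h. Y i \<omega> = rev h ! i}"

definition weight :: "config list \<Rightarrow> real" where "weight h = measure M (cylinder h)"

text \<open>The expectation of \<open>F (Y n)\<close> as a finite sum over the histories possible in
  \<open>n\<close> steps; \<open>expect_const\<close> shows that these carry all the mass.\<close>

definition expect :: "nat \<Rightarrow> (config \<Rightarrow> real) \<Rightarrow> real" where
  "expect n F = (\<Sum>h\<in>histories c0 n. weight h * F (hd h))"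

lemma cylinder_meas [measurable]: "cylinder h \<in> sets M"
  unfolding cylinder_def by measurable

lemma exited_meas [measurable]: "{\<omega> \<in> space M. exited (Y i \<omega>)} \<in> sets M"
proof -
  have "Y i -` {c. exited c} \<inter> space M \<in> sets M" by (rule measurable_sets[OF Y_meas]) simp
  then show ?thesis by (simp add: vimage_def Int_def conj_commute)
qed

lemma exited_le_meas: "{\<omega> \<in> space M. \<exists>i\<le>n. exited (Y i \<omega>)} \<in> sets M"
proof -
  have "{\<omega> \<in> space M. \<exists>i\<le>n. exited (Y i \<omega>)} = (\<Union>i\<in>{..n}. {\<omega> \<in> space M. exited (Y i \<omega>)})" by auto
  then show ?thesis by auto
qed

text \<open>The law is used with all thresholds \<open>0\<close>, where positivity of the holding
  times makes the conditions on \<open>S\<close> vacuous.\<close>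

lemma weight_Cons:
  assumes "h \<noteq> []"
  shows "weight (d # h) = weight h * (tasep_rate \<alpha> (hd h) d / exit_rate (tasep_rate \<alpha>) (hd h))"
proof -
  obtain n where n: "length h = Suc n" using assms by (cases h) auto
  define y where "y i = rev (d # h) ! i" for i
  have "measure M {\<omega> \<in> space M. (\<forall>i\<le>Suc n. Y i \<omega> = y i) \<and> (\<forall>i\<le>n. 0 < S i \<omega>)} =
      measure M {\<omega> \<in> space M. (\<forall>i\<le>n. Y i \<omega> = y i) \<and> (\<forall>i<n. 0 < S i \<omega>)}
        * (tasep_rate \<alpha> (y n) (y (Suc n)) / exit_rate (tasep_rate \<alpha>) (y n))"
    using law[unfolded jump_chain_law_def, THEN spec[of _ n], THEN spec[of _ y], THEN spec[of _ "\<lambda>_. 0"]] by simp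
  moreover have "{\<omega> \<in> space M. (\<forall>i\<le>Suc n. Y i \<omega> = y i) \<and> (\<forall>i\<le>n. 0 < S i \<omega>)} = cylinder (d # h)"
    unfolding cylinder_def by (auto simp: n y_def S_pos less_Suc_eq_le)
  moreover have "{\<omega> \<in> space M. (\<forall>i\<le>n. Y i \<omega> = y i) \<and> (\<forall>i<n. 0 < S i \<omega>)} = cylinder h"
    unfolding cylinder_def by (auto simp: n y_def S_pos less_Suc_eq_le nth_append)
  moreover have "y n = hd h" "y (Suc n) = d"
    using assms by (simp_all add: y_def nth_append n rev_nth hd_conv_nth)
  ultimately show ?thesis by (simp add: weight_def)
qed

lemma expect_Suc: "expect (Suc n) F = expect n (\<lambda>c. F c + gen \<alpha> F c / total_rate \<alpha> c)"
proof -
  have nonempty: "h \<noteq> []" and adm: "admissible (m0 + n) (hd h)" if "h \<in> histories c0 n" for h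
    using histories_props[OF adm0 that] by auto
  have "expect (Suc n) F = (\<Sum>h\<in>histories c0 n. \<Sum>h'\<in>(\<lambda>d. d # h) ` targets (hd h). weight h' * F (hd h'))"
    unfolding expect_def histories.simps
    by (rule sum.UNION_disjoint) (use finite_histories[OF adm0] finite_targets[OF adm] in auto)
  also have "\<dots> = expect n (\<lambda>c. F c + gen \<alpha> F c / total_rate \<alpha> c)"
    unfolding expect_def
  proof (rule sum.cong[OF refl])
    fix h assume h: "h \<in> histories c0 n"
    have "(\<Sum>h'\<in>(\<lambda>d. d # h) ` targets (hd h). weight h' * F (hd h')) = (\<Sum>d\<in>targets (hd h). weight (d # h) * F d)"
      by (subst sum.reindex) (auto simp: inj_on_def)
    also have "\<dots> = (\<Sum>d\<in>targets (hd h). weight h / total_rate \<alpha> (hd h) * (tasep_rate \<alpha> (hd h) d * F d))"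
      by (rule sum.cong) (simp_all add: weight_Cons nonempty[OF h] exit_rate_tasep[OF adm[OF h]])
    also have "\<dots> = weight h * (F (hd h) + gen \<alpha> F (hd h) / total_rate \<alpha> (hd h))"
      unfolding sum_distrib_left[symmetric] tasep_rate_sum[OF adm[OF h]]
      using total_rate_bounds(1)[OF \<alpha> adm[OF h]] by (simp add: field_simps)
    finally show "(\<Sum>h'\<in>(\<lambda>d. d # h) ` targets (hd h). weight h' * F (hd h')) = weight h * (F (hd h) + gen \<alpha> F (hd h) / total_rate \<alpha> (hd h))" .
  qed
  finally show ?thesis .
qed

lemma expect_0: "expect 0 F = F c0"
proof -
  have "cylinder [c0] = space M" by (auto simp: cylinder_def Y0)
  then show ?thesis by (simp add: expect_def weight_def prob_space)
qed

lemma expect_mono: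
  assumes "\<And>c. admissible (m0 + n) c \<Longrightarrow> F c \<le> G c"
  shows "expect n F \<le> expect n G"
  unfolding expect_def using assms histories_props[OF adm0]
  by (intro sum_mono mult_left_mono) (auto simp: weight_def)

lemma expect_add: "expect n (\<lambda>c. F c + G c) = expect n F + expect n G"
  by (simp add: expect_def distrib_left sum.distrib)

lemma expect_cmult: "expect n (\<lambda>c. a * F c) = a * expect n F"
  by (simp add: expect_def sum_distrib_left mult.left_commute)

lemma expect_const: "expect n (\<lambda>c. a) = a"
proof (induction n)
  case (Suc n)
  have "gen \<alpha> (\<lambda>c. a) = (\<lambda>c. 0)" by (simp add: gen_def fun_eq_iff)
  then show ?case using Suc by (simp add: expect_Suc)
qed (simp add: expect_0)

text \<open>Exit is absorbing, so whether it has occurred by step \<open>n\<close> can be read off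
  the last state. The cylinders are disjoint and cover the space almost surely.\<close>

lemma expect_exited: "measure M {\<omega> \<in> space M. \<exists>i\<le>n. exited (Y i \<omega>)} = expect n (\<lambda>c. of_bool (exited c))"
proof -
  let ?A = "{\<omega> \<in> space M. \<exists>i\<le>n. exited (Y i \<omega>)}"
  note A = exited_le_meas[of n]
  let ?U = "\<Union>h\<in>histories c0 n. cylinder h"
  have disj: "disjoint_family_on cylinder (histories c0 n)"
    unfolding disjoint_family_on_def
  proof (intro ballI impI equals0I)
    fix h h' \<omega> assume *: "h \<in> histories c0 n" "h' \<in> histories c0 n" "h \<noteq> h'" "\<omega> \<in> cylinder h \<inter> cylinder h'"
    then have "length h = length h'" using histories_props[OF adm0] by simp
    then have "rev h = rev h'" using * by (intro nth_equalityI) (auto simp: cylinder_def)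
    then show False using * by simp
  qed
  have "measure M ?U = (\<Sum>h\<in>histories c0 n. weight h)"
    unfolding weight_def by (rule finite_measure_finite_Union) (use finite_histories[OF adm0] disj in auto)
  also have "\<dots> = 1" using expect_const[of n 1] by (simp add: expect_def)
  finally have U: "measure M ?U = 1" .
  have Um: "?U \<in> sets M" using finite_histories[OF adm0] by auto
  have "AE \<omega> in M. \<omega> \<in> ?U" using U Um by (simp add: prob_eq_1)
  then have "measure M ?A = measure M (\<Union>h\<in>histories c0 n. ?A \<inter> cylinder h)"
    by (intro finite_measure_eq_AE) (use A Um finite_histories[OF adm0] in auto)
  also have "\<dots> = (\<Sum>h\<in>histories c0 n. measure M (?A \<inter> cylinder h))"
    by (rule finite_measure_finite_Union)
      (use finite_histories[OF adm0] A disj in \<open>auto simp: disjoint_family_on_def\<close>)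
  also have "\<dots> = expect n (\<lambda>c. of_bool (exited c))"
    unfolding expect_def
  proof (rule sum.cong[OF refl])
    fix h assume h: "h \<in> histories c0 n"
    note p = histories_props[OF adm0 h]
    have "(\<exists>i\<le>n. exited (Y i \<omega>)) \<longleftrightarrow> exited (hd h)" if "\<omega> \<in> cylinder h" for \<omega>
    proof -
      have "(\<exists>c\<in>set h. exited c) \<longleftrightarrow> (\<exists>i<length h. exited (rev h ! i))"
        by (metis in_set_conv_nth length_rev set_rev)
      also have "\<dots> \<longleftrightarrow> (\<exists>i\<le>n. exited (Y i \<omega>))" using that p by (auto simp: cylinder_def less_Suc_eq_le)
      finally show ?thesis using p by simp
    qed
    then have "?A \<inter> cylinder h = (if exited (hd h) then cylinder h else {})" by (auto simp: cylinder_def)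
    then show "measure M (?A \<inter> cylinder h) = weight h * of_bool (exited (hd h))" by (simp add: weight_def)
  qed
  finally show ?thesis .
qed

definition lingering :: "nat \<Rightarrow> config \<Rightarrow> real" where
  "lingering B c = of_bool (\<exists>x. 1 \<le> x \<and> x \<le> B \<and> c x = Second)"

text \<open>The potential gains at least \<open>\<theta> ^ (B * B) / (m0 + n + \<alpha>)\<close> in a step from a state with the second class
  particle in \<open>{1..B}\<close>, and it is bounded; the harmonic series diverges.\<close>

lemma lingering_small:
  assumes "0 < \<epsilon>"
  shows "\<exists>n\<ge>N. expect n (lingering B) < \<epsilon>"
proof (rule ccontr)
  assume "\<not> ?thesis"
  then have big: "\<epsilon> \<le> expect n (lingering B)" if "N \<le> n" for n using that by (meson linorder_not_le)
  define \<theta> where "\<theta> = 1 / (1 + 2 / min 1 \<alpha>)"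
  have \<theta>: "0 < \<theta>" "\<theta> \<le> 1" "min 1 \<alpha> * (1 / \<theta> - 1) = 2"
    using \<alpha> by (auto simp: \<theta>_def divide_simps min_def add_pos_pos)
  define \<delta> where "\<delta> = \<theta> ^ (B * B)"
  have \<delta>: "0 < \<delta>" using \<theta> by (simp add: \<delta>_def)
  have step: "expect n (potential \<theta>) + \<delta> * expect n (lingering B) / (real (m0 + n) + \<alpha>) \<le> expect (Suc n) (potential \<theta>)" for n
  proof -
    have "expect n (\<lambda>c. potential \<theta> c + \<delta> / (real (m0 + n) + \<alpha>) * lingering B c) \<le> expect (Suc n) (potential \<theta>)"
      unfolding expect_Suc
    proof (rule expect_mono)
      fix c assume adm: "admissible (m0 + n) c"
      note r = total_rate_bounds[OF \<alpha> adm]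
      show "potential \<theta> c + \<delta> / (real (m0 + n) + \<alpha>) * lingering B c \<le> potential \<theta> c + gen \<alpha> (potential \<theta>) c / total_rate \<alpha> c"
      proof (cases "exited c")
        case True
        then have "lingering B c = 0" by (auto simp: lingering_def exited_def)
        then show ?thesis using gen_potential_exited[OF adm True] by simp
      next
        case False
        then obtain x where x: "1 \<le> x" "c x = Second" by (auto simp: exited_def)
        note g = gen_potential[OF \<alpha> \<theta> adm x]
        have "\<delta> * lingering B c \<le> potential \<theta> c"
        proof (cases "lingering B c = 0")
          case True
          then show ?thesis using potential_bounds[OF \<theta>(1,2), of c] by simp
        next
          case False
          then obtain z where "1 \<le> z" "z \<le> B" "c z = Second" "lingering B c = 1" by (auto simp: lingering_def)
          then show ?thesis using potential_lower[OF \<theta>(1,2) adm] by (simp add: \<delta>_def)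
        qed
        with g have "\<delta> * lingering B c \<le> gen \<alpha> (potential \<theta>) c" by simp
        moreover have "0 \<le> \<delta> * lingering B c" using \<delta> by (simp add: lingering_def)
        ultimately have "\<delta> * lingering B c / (real (m0 + n) + \<alpha>) \<le> gen \<alpha> (potential \<theta>) c / total_rate \<alpha> c"
          using r by (intro frac_le) auto
        then show ?thesis by simp
      qed
    qed
    then show ?thesis unfolding expect_add expect_cmult by simp
  qed
  have lower: "\<delta> * \<epsilon> * (\<Sum>i<n. 1 / (real (m0 + N + i) + \<alpha>)) \<le> expect (N + n) (potential \<theta>)" for n
  proof (induction n)
    case 0
    have "expect N (\<lambda>_. 0) \<le> expect N (potential \<theta>)"
      by (rule expect_mono) (simp add: potential_bounds[OF \<theta>(1,2)] less_imp_le)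
    then show ?case by (simp add: expect_const)
  next
    case (Suc n)
    have "\<delta> * \<epsilon> * (1 / (real (m0 + N + n) + \<alpha>)) \<le> \<delta> * expect (N + n) (lingering B) / (real (m0 + (N + n)) + \<alpha>)"
      using big[of "N + n"] \<delta> \<alpha> by (simp add: add.assoc divide_right_mono)
    then show ?case using Suc step[of "N + n"] by (simp add: distrib_left)
  qed
  have upper: "expect n (potential \<theta>) \<le> 1" for n
    using expect_mono[of n "potential \<theta>" "\<lambda>_. 1"] potential_bounds[OF \<theta>(1,2)] by (simp add: expect_const)
  have "summable (\<lambda>i. 1 / (real (m0 + N + i) + \<alpha>))"
  proof (rule summableI_nonneg_bounded[where x = "1 / (\<delta> * \<epsilon>)"])
    fix n
    show "(\<Sum>i<n. 1 / (real (m0 + N + i) + \<alpha>)) \<le> 1 / (\<delta> * \<epsilon>)"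
      using order_trans[OF lower[of n] upper] \<delta> assms by (simp add: pos_le_divide_eq mult.commute)
  qed (use \<alpha> in auto)
  \<comment> \<open>A constant multiple of the harmonic series is a lower bound, against the
    summability just obtained.\<close>
  moreover have "1 / (real (m0 + N) + \<alpha> + 1) * (1 / (real i + 1)) \<le> 1 / (real (m0 + N + i) + \<alpha>)" for i
  proof -
    have "0 \<le> real (m0 + N) * real i" "0 \<le> \<alpha> * real i" using \<alpha> by auto
    then have "real (m0 + N + i) + \<alpha> \<le> (real (m0 + N) + \<alpha> + 1) * (real i + 1)" using \<alpha> by (simp add: algebra_simps)
    then have "1 / ((real (m0 + N) + \<alpha> + 1) * (real i + 1)) \<le> 1 / (real (m0 + N + i) + \<alpha>)" using \<alpha> by (intro divide_left_mono mult_pos_pos) auto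
    then show ?thesis by simp
  qed
  ultimately have "summable (\<lambda>i. 1 / (real (m0 + N) + \<alpha> + 1) * (1 / (real i + 1)))"
    by (rule_tac summable_comparison_test') (use \<alpha> in \<open>auto simp: abs_mult\<close>)
  then have "summable (\<lambda>i. 1 / (real i + 1))"
    using \<alpha> by (subst (asm) summable_cmult_iff) auto
  then have "summable (\<lambda>i. inverse (real (Suc i)))" by (simp add: inverse_eq_divide add.commute)
  then show False using not_summable_harmonic[where 'a = real] summable_Suc_iff[of "\<lambda>i. inverse (real i)"] by simp
qed

section \<open>Squeezing the exit probability\<close>

definition exit_probability :: real where
  "exit_probability = measure M {\<omega> \<in> space M. \<exists>i. exited (Y i \<omega>)}"

lemma exited_limit: "(\<lambda>n. expect n (\<lambda>c. of_bool (exited c))) \<longlonglongrightarrow> exit_probability"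
proof -
  let ?A = "\<lambda>n. {\<omega> \<in> space M. \<exists>i\<le>n. exited (Y i \<omega>)}"
  note A = exited_le_meas
  have "(\<lambda>n. measure M (?A n)) \<longlonglongrightarrow> measure M (\<Union>n. ?A n)"
    by (rule finite_Lim_measure_incseq) (use A in \<open>auto simp: incseq_def intro: order_trans\<close>)
  moreover have "(\<Union>n. ?A n) = {\<omega> \<in> space M. \<exists>i. exited (Y i \<omega>)}" by auto
  ultimately show ?thesis by (simp add: expect_exited exit_probability_def)
qed

lemma expect_exited_le: "expect n (\<lambda>c. of_bool (exited c)) \<le> exit_probability"
proof (rule incseq_le[OF incseq_SucI exited_limit])
  fix n
  show "expect n (\<lambda>c. of_bool (exited c)) \<le> expect (Suc n) (\<lambda>c. of_bool (exited c))"
    unfolding expect_exited[symmetric]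
  proof (rule finite_measure_mono)
    show "{\<omega> \<in> space M. \<exists>i\<le>Suc n. exited (Y i \<omega>)} \<in> sets M" by (rule exited_le_meas)
  qed (auto intro: le_SucI)
qed

text \<open>By subharmonicity the initial value is at most the expectation at any step
  \<open>n\<close>. That is bounded by the probability of exit plus that of lingering in the first
  \<open>Suc L\<close> sites, and the latter is small for suitable \<open>n\<close>.\<close>

lemma exit_fun_le_probability: "exit_fun \<alpha> (Suc L) c0 \<le> exit_probability"
proof (rule field_le_epsilon)
  fix \<epsilon> :: real assume "0 < \<epsilon>"
  then obtain n where n: "expect n (lingering (Suc L)) < \<epsilon>" using lingering_small by blast
  have "exit_fun \<alpha> (Suc L) c0 \<le> expect n (exit_fun \<alpha> (Suc L))" for n
  proof (induction n)
    case (Suc n)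
    have "expect n (exit_fun \<alpha> (Suc L)) \<le> expect (Suc n) (exit_fun \<alpha> (Suc L))"
      unfolding expect_Suc
      by (rule expect_mono) (use gen_exit_fun_nonneg[OF \<alpha>] total_rate_bounds(1)[OF \<alpha>] in \<open>auto intro!: divide_nonneg_pos\<close>)
    with Suc show ?case by simp
  qed (simp add: expect_0)
  also have "expect n (exit_fun \<alpha> (Suc L)) \<le> expect n (\<lambda>c. of_bool (exited c) + lingering (Suc L) c)"
    by (rule expect_mono) (use exit_fun_le[OF \<alpha>] in \<open>auto simp: lingering_def\<close>)
  finally have "exit_fun \<alpha> (Suc L) c0 \<le> expect n (\<lambda>c. of_bool (exited c) + lingering (Suc L) c)" .
  then show "exit_fun \<alpha> (Suc L) c0 \<le> exit_probability + \<epsilon>"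
    using n expect_exited_le[of n] by (simp add: expect_add)
qed

text \<open>Until step \<open>n\<close> the particles stay in the range where
  \<open>exit_fun\<close> is harmonic, so its expectation is preserved; it dominates the exit
  indicator.\<close>

lemma expect_exited_le_exit_fun:
  assumes "m0 + n \<le> Suc L"
  shows "expect n (\<lambda>c. of_bool (exited c)) \<le> exit_fun \<alpha> (Suc L) c0"
proof -
  have "expect i (exit_fun \<alpha> (Suc L)) \<le> exit_fun \<alpha> (Suc L) c0" if "i \<le> n" for i
    using that
  proof (induction i)
    case (Suc i)
    have "expect (Suc i) (exit_fun \<alpha> (Suc L)) \<le> expect i (exit_fun \<alpha> (Suc L))"
      unfolding expect_Suc
      by (rule expect_mono) (use gen_exit_fun_zero[OF \<alpha>] Suc.prems assms in auto)
    with Suc show ?case by simp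
  qed (simp add: expect_0)
  moreover have "expect n (\<lambda>c. of_bool (exited c)) \<le> expect n (exit_fun \<alpha> (Suc L))"
    by (rule expect_mono) (rule exit_fun_nonneg[OF \<alpha>])
  ultimately show ?thesis by (meson order_refl order_trans)
qed

lemma exit_fun_limit: "(\<lambda>L. exit_fun \<alpha> L c0) \<longlonglongrightarrow> exit_probability"
proof (subst filterlim_sequentially_Suc[symmetric], rule LIMSEQ_I)
  fix r :: real assume "0 < r"
  then obtain n where n: "\<bar>expect n (\<lambda>c. of_bool (exited c)) - exit_probability\<bar> < r"
    using LIMSEQ_D[OF exited_limit] by (metis order_refl real_norm_def)
  show "\<exists>no. \<forall>L\<ge>no. norm (exit_fun \<alpha> (Suc L) c0 - exit_probability) < r"
  proof (intro exI[of _ "m0 + n"] allI impI)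
    fix L assume "m0 + n \<le> L"
    then have "expect n (\<lambda>c. of_bool (exited c)) \<le> exit_fun \<alpha> (Suc L) c0" by (intro expect_exited_le_exit_fun) simp
    then show "norm (exit_fun \<alpha> (Suc L) c0 - exit_probability) < r"
      using n exit_fun_le_probability[of L] by simp
  qed
qed

end

text \<open>Every state of the jump chain is visited in continuous time: at the \<open>i\<close>-th
  jump time the only interval containing that time is the \<open>i\<close>-th, by strict
  monotonicity of the jump times.\<close>

lemma exit_event_jump_chain:
  assumes pos: "\<And>n \<omega>. \<omega> \<in> space M \<Longrightarrow> 0 < S n \<omega>"
    and path: "\<And>\<omega> t. \<omega> \<in> space M \<Longrightarrow> 0 \<le> t \<Longrightarrow> \<exists>n. jump_time S n \<omega> \<le> t \<and> t < jump_time S (Suc n) \<omega> \<and> X t \<omega> = Y n \<omega>"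
  shows "exit_event M X = {\<omega> \<in> space M. \<exists>i. exited (Y i \<omega>)}"
proof (intro set_eqI iffI)
  fix \<omega> assume "\<omega> \<in> exit_event M X"
  then obtain t where t: "\<omega> \<in> space M" "0 \<le> t" "exited (X t \<omega>)" by (auto simp: exit_event_def exited_def)
  then show "\<omega> \<in> {\<omega> \<in> space M. \<exists>i. exited (Y i \<omega>)}" using path[OF t(1,2)] by auto
next
  fix \<omega> assume "\<omega> \<in> {\<omega> \<in> space M. \<exists>i. exited (Y i \<omega>)}"
  then obtain i where \<omega>: "\<omega> \<in> space M" and i: "exited (Y i \<omega>)" by auto
  have mono: "strict_mono (\<lambda>n. jump_time S n \<omega>)"
    by (rule strict_monoI_Suc) (simp add: jump_time_def pos[OF \<omega>])
  have nn: "0 \<le> jump_time S i \<omega>" using pos[OF \<omega>] by (simp add: jump_time_def sum_nonneg less_imp_le)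
  obtain n where n: "jump_time S n \<omega> \<le> jump_time S i \<omega>" "jump_time S i \<omega> < jump_time S (Suc n) \<omega>" "X (jump_time S i \<omega>) \<omega> = Y n \<omega>"
    using path[OF \<omega> nn] by blast
  have "n = i" using n(1,2) strict_mono_less_eq[OF mono] strict_mono_less[OF mono] by fastforce
  then have "exited (X (jump_time S i \<omega>) \<omega>)" using n i by simp
  then show "\<omega> \<in> exit_event M X" using \<omega> nn by (auto simp: exit_event_def exited_def)
qed

lemma admissible_init: "admissible l (init_config k l)" if "k \<le> l"
  using that by (auto simp: admissible_def init_config_def)

theorem theorem4p3:
  fixes \<alpha> :: real and k l :: nat
    and M :: "'w measure" and X :: "real \<Rightarrow> 'w \<Rightarrow> config"
  assumes "\<alpha> > 0" and "1 \<le> k" and "k \<le> l"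
    and "markov_jump_process M (tasep_rate \<alpha>) (init_config k l) X"
  shows "(\<alpha> \<ge> 1/2 \<longrightarrow>
            measure M (exit_event M X) =
              (1 + (2 * rho \<alpha> k - 1) * real (l - k + 1)) / 2 ^ (l - k + 1))
       \<and> (\<alpha> \<le> 1/2 \<longrightarrow> measure M (exit_event M X) = \<alpha> ^ (l - k + 1))"
proof -
  obtain Y S where M: "prob_space M"
    and Y: "\<And>n. Y n \<in> measurable M (count_space UNIV)"
    and Y0: "\<And>\<omega>. \<omega> \<in> space M \<Longrightarrow> Y 0 \<omega> = init_config k l"
    and S: "\<And>n \<omega>. \<omega> \<in> space M \<Longrightarrow> 0 < S n \<omega>"
    and law: "jump_chain_law M (tasep_rate \<alpha>) Y S"
    and path: "\<And>\<omega> t. \<omega> \<in> space M \<Longrightarrow> 0 \<le> t \<Longrightarrow> \<exists>n. jump_time S n \<omega> \<le> t \<and> t < jump_time S (Suc n) \<omega> \<and> X t \<omega> = Y n \<omega>"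
    using assms(4) unfolding markov_jump_process_def by blast
  interpret prob_space M by (rule M)
  interpret tasep_jump_chain M \<alpha> "init_config k l" l Y S
    by unfold_locales (use assms(1) admissible_init[OF assms(3)] Y Y0 S law in auto)
  have "exit_event M X = {\<omega> \<in> space M. \<exists>i. exited (Y i \<omega>)}"
    using S path by (rule exit_event_jump_chain)
  then have event: "measure M (exit_event M X) = exit_probability"
    by (simp add: exit_probability_def)
  define m where "m = l - k + 1"
  \<comment> \<open>Only segments long enough to contain the second class particle are considered:
    \<open>k - 1 + m\<close> equals \<open>l\<close>, so \<open>N\<close> counts the sites beyond
    it.\<close>
  have "(\<lambda>N. exit_fun \<alpha> (N + (k - 1 + m)) (init_config k l)) \<longlonglongrightarrow> exit_probability"
    by (rule LIMSEQ_ignore_initial_segment[OF exit_fun_limit])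
  then have lim: "(\<lambda>N. poly ((opC ^^ (k - 1)) ((opD ^^ m) (cpow N))) (1 / \<alpha>) / poly (cpow (k - 1 + m + N)) (1 / \<alpha>))
      \<longlonglongrightarrow> exit_probability"
    unfolding m_def add.commute[of _ "k - 1 + (l - k + 1)"] exit_fun_init[OF assms(2,3)] .
  have "exit_probability = (1 + (2 * rho \<alpha> k - 1) * real m) / 2 ^ m" if "1 / 2 \<le> \<alpha>"
    using LIMSEQ_unique[OF lim block_probability_max_current[OF that]] assms(2) by simp
  moreover have "exit_probability = \<alpha> ^ m" if "\<alpha> \<le> 1 / 2"
    by (rule LIMSEQ_unique[OF lim block_probability_low_density[OF assms(1) that]])
  ultimately show ?thesis unfolding event m_def by blast
qed

end
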